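(* Let $K$ be a field and $n\ge1$. Let $\lambda=(\lambda_1,\dots,\lambda_n)\in\mathscr{P}_n$ and let $\lambda'=(\lambda'_1,\dots,\lambda'_m)$ be the conjugate partition of $\lambda$, where $m\ge\ell(\lambda')$. Then, in the nilHecke algebra $\mathscr{H}_n^{(0)}$, $$b_\lambda=\det\bigl(b_{(\lambda_i-i+j)}\bigr)_{1\le i,j\le n},\qquad b_\lambda=\det\bigl(b_{(1^{\lambda'_i-i+j})}\bigr)_{1\le i,j\le m},$$ where by definition $b_{(s)}=0$ and $b_{(1^s)}=0$ if $s<0$, and $b_{(1^k)}=0$ if $k>n$.
   Context: $\mathscr{H}_n^{(0)}$ is the unital associative $K$-algebra generated by $\psi_1,\dots,\psi_{n-1},y_1,\dots,y_n$ with relations: $\psi_r^2=0$; $\psi_r\psi_k=\psi_k\psi_r$ if $|r-k|>1$; $\psi_r\psi_{r+1}\psi_r=\psi_{r+1}\psi_r\psi_{r+1}$; $y_ry_k=y_ky_r$; $\psi_ry_{r+1}=y_r\psi_r+1$, $y_{r+1}\psi_r=\psi_ry_r+1$; $\psi_ry_k=y_k\psi_r$ if $k\ne r,r+1$. For $w\in\mathfrak{S}_n$ with reduced expression $w=s_{i_1}\cdots s_{i_k}$ ($s_i=(i,i+1)$), $\psi_w:=\psi_{i_1}\cdots\psi_{i_k}$ (independent of the reduced expression); $w_0$ is the longest element of $\mathfrak{S}_n$. $\mathscr{P}_n$ is the set of partitions $\lambda=(\lambda_1\ge\dots\ge\lambda_n\ge0)$ of length at most $n$, the length $\ell(\lambda)$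 being the number of nonzero parts. The conjugate of $\lambda$ is given by $\lambda'_k=\#\{j:\lambda_j\ge k\}$. $(1^k)$ is the partition with $k$ parts equal to $1$, and $(s)$ is the one-row partition; $(1^0)=(0)$ is the empty partition. For $\lambda\in\mathscr{P}_n$, $$b_\lambda:=\psi_{w_0}y_1^{\lambda_1+n-1}y_2^{\lambda_2+n-2}\cdots y_n^{\lambda_n}\,\psi_{w_0}\,y_1^{n-1}y_2^{n-2}\cdots y_{n-1}.$$ The elements $b_\mu$ ($\mu\in\mathscr{P}_n$) commute pairwise, so the determinants are well defined by the Leibniz formula $\det(a_{ij})=\sum_\sigma\operatorname{sgn}(\sigma)\prod_ia_{i\sigma(i)}$. Note that $b_{(0)}=b_{(1^0)}$ is the element given by the formula above for the empty partition, not the identity of $\mathscr{H}_n^{(0)}$.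
   Formalization: The formal statement assumes m ≥ 1: for λ empty and m = 0 the second determinant is the empty determinant 1, whereas b_(0) is not the identity when n ≥ 2, so the identity fails there. *)

theory Defs
  imports "HOL-Library.Cardinality" "HOL-Library.Poly_Mapping" "HOL-Combinatorics.Permutations"
begin

section \<open>The nilHecke algebra\<close>

text \<open>
  The rank \<open>n \<ge> 1\<close> is \<open>CARD('n)\<close> for a finite type \<open>'n\<close>. The generators carry the
  natural-number indices \<open>1, \<dots>, n - 1\<close> and \<open>1, \<dots>, n\<close>.
\<close>

datatype gen_symbol = Psi nat | Y nat

typedef (overloaded) ('n::finite) gen =
  "Psi ` {1..<CARD('n)} \<union> Y ` {1..CARD('n)}"
proof
  show "Y 1 \<in> Psi ` {1..<CARD('n)} \<union> Y ` {1..CARD('n)}"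
    by (simp add: Suc_le_eq)
qed

text \<open>
  The free monoid on a type, written additively so that the finitely supported functions
  on it form, under the convolution product of \<open>poly_mapping\<close>, the free algebra.
\<close>

datatype 'a fmonoid = FWord (letters: "'a list")

instantiation fmonoid :: (type) monoid_add
begin
definition "0 = FWord []"
definition "u + v = FWord (letters u @ letters v)"
instance
  by standard (simp_all add: zero_fmonoid_def plus_fmonoid_def)
end

type_synonym ('k, 'n) free_alg = "'n gen fmonoid \<Rightarrow>\<^sub>0 'k"

definition psi0 :: "nat \<Rightarrow> ('k::field, 'n::finite) free_alg"
  where "psi0 r = Poly_Mapping.single (FWord [Abs_gen (Psi r)]) 1"

definition y0 :: "nat \<Rightarrow> ('k::field, 'n::finite) free_alg"
  where "y0 r = Poly_Mapping.single (FWord [Abs_gen (Y r)]) 1"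

text \<open>
  The smallest ring congruence on the free algebra containing the defining relations.
  Scalars are the elements \<open>Poly_Mapping.single 0 c\<close> of the free algebra, so by reflexivity
  and compatibility with products the congruence is also \<open>K\<close>-linear.
\<close>

inductive nh_cong :: "('k::field, 'n::finite) free_alg \<Rightarrow> ('k, 'n) free_alg \<Rightarrow> bool" where
  refl: "nh_cong a a"
| sym: "nh_cong a b \<Longrightarrow> nh_cong b a"
| trans: "nh_cong a b \<Longrightarrow> nh_cong b c \<Longrightarrow> nh_cong a c"
| add: "nh_cong a b \<Longrightarrow> nh_cong c d \<Longrightarrow> nh_cong (a + c) (b + d)"
| mult: "nh_cong a b \<Longrightarrow> nh_cong c d \<Longrightarrow> nh_cong (a * c) (b * d)"
| psi_square: "r \<in> {1..<CARD('n)} \<Longrightarrow> nh_cong (psi0 r * psi0 r) 0"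
| psi_comm: "r \<in> {1..<CARD('n)} \<Longrightarrow> k \<in> {1..<CARD('n)} \<Longrightarrow> \<bar>int r - int k\<bar> > 1 \<Longrightarrow>
    nh_cong (psi0 r * psi0 k) (psi0 k * psi0 r)"
| psi_braid: "r \<in> {1..<CARD('n)} \<Longrightarrow> r + 1 \<in> {1..<CARD('n)} \<Longrightarrow>
    nh_cong (psi0 r * psi0 (r + 1) * psi0 r) (psi0 (r + 1) * psi0 r * psi0 (r + 1))"
| y_comm: "r \<in> {1..CARD('n)} \<Longrightarrow> k \<in> {1..CARD('n)} \<Longrightarrow> nh_cong (y0 r * y0 k) (y0 k * y0 r)"
| psi_y_Suc: "r \<in> {1..<CARD('n)} \<Longrightarrow> nh_cong (psi0 r * y0 (r + 1)) (y0 r * psi0 r + 1)"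
| y_Suc_psi: "r \<in> {1..<CARD('n)} \<Longrightarrow> nh_cong (y0 (r + 1) * psi0 r) (psi0 r * y0 r + 1)"
| psi_y_comm: "r \<in> {1..<CARD('n)} \<Longrightarrow> k \<in> {1..CARD('n)} \<Longrightarrow> k \<noteq> r \<Longrightarrow> k \<noteq> r + 1 \<Longrightarrow>
    nh_cong (psi0 r * y0 k) (y0 k * psi0 r)"

lemma nh_cong_minus:
  assumes "nh_cong a b" shows "nh_cong (- a) (- b)"
proof -
  have "nh_cong ((- 1) * a) ((- 1) * b)"
    using assms by (intro nh_cong.mult nh_cong.refl)
  then show ?thesis by simp
qed

quotient_type (overloaded) ('k, 'n) nilhecke =
  "('k::field, 'n::finite) free_alg" / nh_cong
  by (rule equivpI)
    (auto intro!: reflpI sympI transpI intro: nh_cong.refl nh_cong.sym nh_cong.trans)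

instantiation nilhecke :: (field, finite) "{ring, monoid_mult}"
begin

lift_definition zero_nilhecke :: "('a, 'b) nilhecke" is 0 .
lift_definition one_nilhecke :: "('a, 'b) nilhecke" is 1 .
lift_definition plus_nilhecke :: "('a, 'b) nilhecke \<Rightarrow> ('a, 'b) nilhecke \<Rightarrow> ('a, 'b) nilhecke"
  is "(+)" by (rule nh_cong.add)
lift_definition uminus_nilhecke :: "('a, 'b) nilhecke \<Rightarrow> ('a, 'b) nilhecke"
  is uminus by (rule nh_cong_minus)
lift_definition minus_nilhecke :: "('a, 'b) nilhecke \<Rightarrow> ('a, 'b) nilhecke \<Rightarrow> ('a, 'b) nilhecke"
  is "(-)" by (metis diff_conv_add_uminus nh_cong.add nh_cong_minus)
lift_definition times_nilhecke :: "('a, 'b) nilhecke \<Rightarrow> ('a, 'b) nilhecke \<Rightarrow> ('a, 'b) nilhecke"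
  is "(*)" by (rule nh_cong.mult)

instance
  by standard (transfer; simp add: algebra_simps nh_cong.refl)+

end

lift_definition nh_psi :: "nat \<Rightarrow> ('k::field, 'n::finite) nilhecke" is psi0 .
lift_definition nh_y :: "nat \<Rightarrow> ('k::field, 'n::finite) nilhecke" is y0 .


section \<open>Reduced expressions\<close>

text \<open>\<open>word_perm [i\<^sub>1, \<dots>, i\<^sub>k] = s\<^bsub>i\<^sub>1\<^esub> \<circ> \<dots> \<circ> s\<^bsub>i\<^sub>k\<^esub>\<close> with \<open>s\<^sub>i = (i, i + 1)\<close>.\<close>

definition word_perm :: "nat list \<Rightarrow> nat \<Rightarrow> nat"
  where "word_perm ws = foldr (\<lambda>i f. transpose i (i + 1) \<circ> f) ws id"

definition is_expression :: "nat \<Rightarrow> (nat \<Rightarrow> nat) \<Rightarrow> nat list \<Rightarrow> bool"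
  where "is_expression n w ws \<longleftrightarrow> set ws \<subseteq> {1..<n} \<and> word_perm ws = w"

definition is_reduced :: "nat \<Rightarrow> (nat \<Rightarrow> nat) \<Rightarrow> nat list \<Rightarrow> bool"
  where "is_reduced n w ws \<longleftrightarrow>
    is_expression n w ws \<and> (\<forall>vs. is_expression n w vs \<longrightarrow> length ws \<le> length vs)"

definition perm_length :: "nat \<Rightarrow> (nat \<Rightarrow> nat) \<Rightarrow> nat"
  where "perm_length n w = (LEAST k. \<exists>ws. is_expression n w ws \<and> length ws = k)"

definition longest_perm :: "nat \<Rightarrow> nat \<Rightarrow> nat"
  where "longest_perm n = (ARG_MAX (perm_length n) w. w permutes {1..n})"

text \<open>
  The value does not depend on the reduced expression that is chosen, by the braid relations.
\<close>

definition psi_perm :: "(nat \<Rightarrow> nat) \<Rightarrow> ('k::field, 'n::finite) nilhecke"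
  where "psi_perm w = prod_list (map nh_psi (SOME ws. is_reduced CARD('n) w ws))"


section \<open>Partitions\<close>

text \<open>
  A partition is a function indexed from 1; the value at 0 is fixed to be 0.
\<close>

definition partitions :: "nat \<Rightarrow> (nat \<Rightarrow> nat) set"
  where "partitions n =
    {lam. (\<forall>i j. 1 \<le> i \<and> i \<le> j \<longrightarrow> lam j \<le> lam i) \<and> (\<forall>i. i \<notin> {1..n} \<longrightarrow> lam i = 0)}"

definition part_length :: "(nat \<Rightarrow> nat) \<Rightarrow> nat"
  where "part_length lam = card {i. lam i \<noteq> 0}"

definition conjugate :: "(nat \<Rightarrow> nat) \<Rightarrow> nat \<Rightarrow> nat"
  where "conjugate lam k = (if k = 0 then 0 else card {j. lam j \<ge> k})"

definition row_partition :: "nat \<Rightarrow> nat \<Rightarrow> nat"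
  where "row_partition s = (\<lambda>i. if i = 1 then s else 0)"

definition column_partition :: "nat \<Rightarrow> nat \<Rightarrow> nat"
  where "column_partition k = (\<lambda>i. if i \<in> {1..k} then 1 else 0)"


section \<open>The elements \<open>b\<^sub>\<lambda>\<close> and determinants\<close>

definition nh_b :: "(nat \<Rightarrow> nat) \<Rightarrow> ('k::field, 'n::finite) nilhecke"
  where "nh_b lam =
    psi_perm (longest_perm CARD('n))
    * prod_list (map (\<lambda>i. nh_y i ^ (lam i + (CARD('n) - i))) [1..<CARD('n) + 1])
    * psi_perm (longest_perm CARD('n))
    * prod_list (map (\<lambda>i. nh_y i ^ (CARD('n) - i)) [1..<CARD('n) + 1])"

definition b_row :: "int \<Rightarrow> ('k::field, 'n::finite) nilhecke"
  where "b_row s = (if s < 0 then 0 else nh_b (row_partition (nat s)))"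

definition b_column :: "int \<Rightarrow> ('k::field, 'n::finite) nilhecke"
  where "b_column s = (if s < 0 \<or> s > int CARD('n) then 0 else nh_b (column_partition (nat s)))"

text \<open>
  Leibniz determinant of an \<open>m \<times> m\<close> matrix with entries in a not necessarily commutative
  ring; the factors of each term are multiplied in the order of the rows.
\<close>

definition leibniz_det :: "nat \<Rightarrow> (nat \<Rightarrow> nat \<Rightarrow> 'a::{ring, monoid_mult}) \<Rightarrow> 'a"
  where "leibniz_det m A =
    (\<Sum>\<sigma> | \<sigma> permutes {1..m}.
      (if evenperm \<sigma> then 1 else - 1) * prod_list (map (\<lambda>i. A i (\<sigma> i)) [1..<m + 1]))"

end

theory Submission
  imports
    "Jordan_Normal_Form.Determinant"
    "HOL-Computational_Algebra.Formal_Power_Series"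
    Defs
begin

text \<open>
  Write \<psi> for \<open>psi_longest\<close>, \<open>\<delta> = (n - 1, \<dots>, 1, 0)\<close>, and \<open>b\<^sub>0\<close> for the element of the
  empty partition. Everything rests on the identity \<open>b\<^sub>\<lambda> = det(h\<^bsub>\<lambda>\<^sub>i - i + j\<^esub>) b\<^sub>0\<close>, where \<open>h\<^sub>k\<close> is the complete
  symmetric function of the \<open>y\<^sub>i\<close>. Symmetric functions of the \<open>y\<^sub>i\<close> commute with \<psi> and with the \<open>y\<^sub>i\<close>,
  and \<open>b\<^sub>0\<close> is idempotent, so a nonempty product of elements \<open>c\<^sub>i b\<^sub>0\<close> with symmetric \<open>c\<^sub>i\<close> collapses to
  \<open>(\<Prod>i. c\<^sub>i) b\<^sub>0\<close>. Since the identity gives \<open>h\<^sub>s b\<^sub>0\<close> for the row \<open>(s)\<close> and \<open>e\<^sub>k b\<^sub>0\<close> for the column \<open>(1\<^sup>k)\<close>, both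
  determinants in the theorem become determinants of symmetric functions times \<open>b\<^sub>0\<close>, and what is left
  is that \<open>det(h\<^bsub>\<lambda>\<^sub>i - i + j\<^esub>) = det(e\<^bsub>\<lambda>'\<^sub>i - i + j\<^esub>)\<close>.

  The identity comes from the map \<open>f \<mapsto> \<psi> f \<psi>\<close> on polynomials in the \<open>y\<^sub>i\<close> (\<open>sandwich\<close>). As \<open>\<psi>\<close> is
  divisible by every \<open>\<psi>\<^sub>r\<close> on both sides and \<open>\<psi>\<^sub>r\<^sup>2 = 0\<close>, this map kills every \<open>f\<close> that commutes with
  some \<open>\<psi>\<^sub>r\<close>, in particular every monomial symmetrised in \<open>y\<^sub>r\<close> and \<open>y\<^bsub>r+1\<^esub>\<close>. So \<open>\<psi> y\<^sup>a \<psi>\<close> is alternating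
  in the exponent vector \<open>a\<close>. All \<open>y\<^sub>i\<close> are roots of one monic polynomial of degree \<open>n\<close> with symmetric
  coefficients, so \<open>y\<^sub>i\<^sup>a\<close> is a symmetric combination of \<open>1, y\<^sub>i, \<dots>, y\<^sub>i\<^bsup>n-1\<^esup>\<close>; multilinear alternating
  expansion turns \<open>\<psi> y\<^bsup>\<lambda>+\<delta>\<^esup> \<psi>\<close> into the determinant of the coefficients times \<open>\<psi> y\<^sup>\<delta> \<psi>\<close>
  (\<open>sandwich_determinant\<close>), and generating functions identify the coefficient matrix with the matrix
  of the \<open>h\<close> up to a unitriangular factor (\<open>sandwich_complete_det\<close>).

  That \<psi> is divisible by every \<open>\<psi>\<^sub>r\<close> needs independence of the reduced word (\<open>matsumoto\<close>), and so does the
  computation \<open>\<psi> y\<^sup>\<delta> \<psi> = \<plusminus>\<psi>\<close>, for which one explicit reduced word is convenient; it gives the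
  idempotency of \<open>b\<^sub>0\<close>. The equality of the two determinants is Jacobi's theorem on complementary minors
  for the mutually inverse Toeplitz matrices of the \<open>h\<^sub>k\<close> and the \<open>(-1)\<^sup>k e\<^sub>k\<close> (\<open>jacobi_trudi_dual\<close>).
\<close>

(* inv is the inverse of a function, $ the coefficient of a power series. *)
unbundle no m_inv_syntax
no_notation vec_index (infixl "$" 100)
unbundle fps_syntax

section \<open>Reduced words in the symmetric group\<close>

lemma word_perm_Nil [simp]: "word_perm [] = id"
  by (simp add: word_perm_def)

lemma word_perm_Cons [simp]: "word_perm (i # ws) = transpose i (i + 1) \<circ> word_perm ws"
  by (simp add: word_perm_def)

lemma word_perm_append [simp]: "word_perm (us @ vs) = word_perm us \<circ> word_perm vs"
  by (induction us) (simp_all add: comp_assoc)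

lemma adjacent_transpose_permutes:
  "i \<in> {1..<n} \<Longrightarrow> transpose i (i + 1) permutes {1..n::nat}"
  by (rule permutes_swap_id) auto

lemma word_perm_permutes: "set ws \<subseteq> {1..<n} \<Longrightarrow> word_perm ws permutes {1..n}"
proof (induction ws)
  case Nil
  show ?case unfolding word_perm_Nil by (rule permutes_id)
next
  case (Cons i ws)
  then show ?case
    unfolding word_perm_Cons
    by (intro permutes_compose adjacent_transpose_permutes) auto
qed

lemma bij_word_perm: "bij (word_perm ws)"
proof (induction ws)
  case Nil
  show ?case unfolding word_perm_Nil by (rule bij_id)
next
  case (Cons i ws)
  then show ?case unfolding word_perm_Cons by (intro bij_comp bij_transpose)
qed

lemma word_perm_rev: "word_perm (rev ws) = inv (word_perm ws)"
proof (induction ws)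
  case Nil
  show ?case by simp
next
  case (Cons i ws)
  have "inv (transpose i (i + 1) \<circ> word_perm ws) = inv (word_perm ws) \<circ> transpose i (i + 1)"
    by (subst o_inv_distrib) (simp_all only: bij_word_perm bij_transpose inv_transpose_eq)
  then show ?case
    unfolding word_perm_Cons
    by (simp only: rev.simps word_perm_append word_perm_Cons word_perm_Nil Cons.IH comp_id)
qed

definition inversions :: "nat \<Rightarrow> (nat \<Rightarrow> nat) \<Rightarrow> (nat \<times> nat) set"
  where "inversions n w = {(i, j). i \<in> {1..n} \<and> j \<in> {1..n} \<and> i < j \<and> w j < w i}"

lemma finite_inversions [simp]: "finite (inversions n w)"
  by (rule finite_subset[of _ "{1..n} \<times> {1..n}"]) (auto simp: inversions_def)

lemma inversions_id [simp]: "inversions n id = {}"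
  by (auto simp: inversions_def)

text \<open>
  Multiplying by \<open>s\<^sub>r\<close> from the left exchanges the values \<open>r\<close> and \<open>r + 1\<close>; no other value lies between
  them, so the pair of their positions is the only one whose order changes.
\<close>

lemma inversions_ascent:
  assumes w: "w permutes {1..n::nat}" and r: "r \<in> {1..<n}" and lt: "inv w r < inv w (r + 1)"
  shows "inversions n (transpose r (r + 1) \<circ> w) = insert (inv w r, inv w (r + 1)) (inversions n w)"
    and "(inv w r, inv w (r + 1)) \<notin> inversions n w"
proof -
  have wr: "w (inv w r) = r" "w (inv w (r + 1)) = r + 1"
    using permutes_inverses(1)[OF w] by auto
  have mem: "inv w r \<in> {1..n}" "inv w (r + 1) \<in> {1..n}"
    using r permutes_in_image[OF permutes_inv[OF w]] by auto
  have inj: "w i = w j \<longleftrightarrow> i = j" for i j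
    using permutes_inj[OF w] by (auto dest: injD)
  have iw: "w i = k \<longleftrightarrow> i = inv w k" for i k
    using permutes_inverses[OF w] by metis
  show "(inv w r, inv w (r + 1)) \<notin> inversions n w"
    using wr by (auto simp: inversions_def)
  have "(i, j) \<in> inversions n (transpose r (r + 1) \<circ> w) \<longleftrightarrow>
      (i, j) \<in> insert (inv w r, inv w (r + 1)) (inversions n w)" for i j
  proof (cases "i \<in> {1..n} \<and> j \<in> {1..n} \<and> i < j")
    case False
    then show ?thesis using mem lt by (auto simp: inversions_def)
  next
    case True
    then have ne: "w i \<noteq> w j" using inj by auto
    have "transpose r (r + 1) (w j) < transpose r (r + 1) (w i) \<longleftrightarrow>
        (w i = r \<and> w j = r + 1) \<or> (w j < w i \<and> \<not> (w i = r + 1 \<and> w j = r))"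
      using ne by (auto simp: transpose_def)
    moreover have "\<not> (w i = r + 1 \<and> w j = r)"
      using True lt iw by (metis not_less_iff_gr_or_eq)
    ultimately show ?thesis
      using True by (auto simp: inversions_def iw)
  qed
  then show "inversions n (transpose r (r + 1) \<circ> w) =
      insert (inv w r, inv w (r + 1)) (inversions n w)" by auto
qed

lemma card_inversions_ascent:
  assumes "w permutes {1..n::nat}" "r \<in> {1..<n}" "inv w r < inv w (r + 1)"
  shows "card (inversions n (transpose r (r + 1) \<circ> w)) = Suc (card (inversions n w))"
  using inversions_ascent[OF assms] by simp

lemma inv_transpose_comp:
  assumes "w permutes {1..n::nat}"
  shows "inv (transpose i (i + 1) \<circ> w) = inv w \<circ> transpose i (i + 1)"
  using assms by (subst o_inv_distrib) (auto simp: permutes_bij)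

lemma transpose_comp_cancel [simp]: "transpose i j \<circ> (transpose i j \<circ> w) = w"
  by (simp add: comp_assoc[symmetric])

lemma card_inversions_descent:
  assumes w: "w permutes {1..n::nat}" and r: "r \<in> {1..<n}" and lt: "inv w (r + 1) < inv w r"
  shows "card (inversions n w) = Suc (card (inversions n (transpose r (r + 1) \<circ> w)))"
proof -
  have "transpose r (r + 1) \<circ> w permutes {1..n}"
    by (intro permutes_compose w adjacent_transpose_permutes r)
  moreover have "inv (transpose r (r + 1) \<circ> w) r < inv (transpose r (r + 1) \<circ> w) (r + 1)"
    using lt unfolding inv_transpose_comp[OF w] by simp
  ultimately show ?thesis
    using card_inversions_ascent[OF _ r] by fastforce
qed

lemma ascent_or_descent:
  assumes "w permutes {1..n::nat}"
  shows "inv w r < inv w (r + 1) \<or> inv w (r + 1) < inv w r"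
proof -
  have "inv w r \<noteq> inv w (r + 1)"
    using permutes_inj[OF permutes_inv[OF assms]] by (metis injD add_eq_self_zero zero_neq_one)
  then show ?thesis by auto
qed

text \<open>
  Every letter changes the number of inversions by exactly one. This makes the number of inversions a
  lower bound for the length of a word; removing descents one by one shows that it is attained.
\<close>

lemma card_inversions_le_length:
  "set ws \<subseteq> {1..<n} \<Longrightarrow> card (inversions n (word_perm ws)) \<le> length ws"
proof (induction ws)
  case (Cons i ws)
  then have w: "word_perm ws permutes {1..n}" and i: "i \<in> {1..<n}"
    using word_perm_permutes[of ws n] by auto
  have "card (inversions n (word_perm ws)) \<le> length ws"
    using Cons by simp
  then show ?case
    unfolding word_perm_Cons length_Cons
    using ascent_or_descent[OF w, of i] card_inversions_ascent[OF w i]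
      card_inversions_descent[OF w i] by linarith
qed simp

lemma strict_increasing_permutes_id:
  assumes p: "p permutes {1..n::nat}" and inc: "\<And>r. r \<in> {1..<n} \<Longrightarrow> p r < p (r + 1)"
  shows "p = id"
proof -
  have ge: "i \<le> p i" if "i \<in> {1..n}" for i
    using that
  proof (induction i)
    case (Suc i)
    show ?case
    proof (cases "i = 0")
      case True
      then show ?thesis using permutes_in_image[OF p, of 1] Suc.prems by auto
    next
      case False
      then have "i \<le> p i" "p i < p (i + 1)"
        using Suc inc by auto
      then show ?thesis by auto
    qed
  qed auto
  have "p i = i" if "i \<in> {1..n}" for i
    using that
  proof (induction "n - i" arbitrary: i rule: less_induct)
    case less
    have "p i \<in> {1..n}" "i \<le> p i"
      using less.prems permutes_in_image[OF p] ge by auto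
    show ?case
    proof (rule ccontr)
      assume "p i \<noteq> i"
      then have "p (p i) = p i"
        using less \<open>p i \<in> {1..n}\<close> \<open>i \<le> p i\<close> by auto
      then show False
        using permutes_inj[OF p] \<open>p i \<noteq> i\<close> by (auto dest: injD)
    qed
  qed
  then show ?thesis
    using permutes_not_in[OF p] by (metis eq_id_iff)
qed

lemma ex_descent:
  assumes w: "w permutes {1..n::nat}" and "w \<noteq> id"
  obtains r where "r \<in> {1..<n}" "inv w (r + 1) < inv w r"
proof -
  have "inv w \<noteq> id"
    using assms by (metis inv_id permutes_inv_inv)
  then obtain r where "r \<in> {1..<n}" "\<not> inv w r < inv w (r + 1)"
    using strict_increasing_permutes_id[OF permutes_inv[OF w]] by blast
  then show thesis
    using that ascent_or_descent[OF w] by blast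
qed

lemma ex_word_of_inversion_length:
  assumes "w permutes {1..n::nat}"
  obtains ws where "set ws \<subseteq> {1..<n}" "word_perm ws = w" "length ws = card (inversions n w)"
proof -
  have "\<exists>ws. set ws \<subseteq> {1..<n} \<and> word_perm ws = w \<and> length ws = card (inversions n w)"
    using assms
  proof (induction "card (inversions n w)" arbitrary: w rule: less_induct)
    case less
    show ?case
    proof (cases "w = id")
      case True
      then show ?thesis by (intro exI[of _ "[]"]) simp
    next
      case False
      then obtain r where r: "r \<in> {1..<n}" "inv w (r + 1) < inv w r"
        using ex_descent less.prems by blast
      let ?w = "transpose r (r + 1) \<circ> w"
      have w': "?w permutes {1..n}"
        by (intro permutes_compose adjacent_transpose_permutes less.prems r)
      have c: "card (inversions n w) = Suc (card (inversions n ?w))"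
        by (rule card_inversions_descent[OF less.prems r])
      then obtain ws where "set ws \<subseteq> {1..<n}" "word_perm ws = ?w" "length ws = card (inversions n ?w)"
        using less.hyps[OF _ w'] by auto
      then show ?thesis
        using r c by (intro exI[of _ "r # ws"]) simp
    qed
  qed
  then show thesis using that by blast
qed

lemma is_reduced_iff:
  assumes "w permutes {1..n::nat}"
  shows "is_reduced n w ws \<longleftrightarrow>
    set ws \<subseteq> {1..<n} \<and> word_perm ws = w \<and> length ws = card (inversions n w)"
proof -
  obtain vs where "set vs \<subseteq> {1..<n}" "word_perm vs = w" "length vs = card (inversions n w)"
    using ex_word_of_inversion_length[OF assms] .
  then show ?thesis
    unfolding is_reduced_def is_expression_def
    using card_inversions_le_length by (metis le_antisym)
qed

lemma perm_length_eq_card_inversions: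
  assumes "w permutes {1..n::nat}"
  shows "perm_length n w = card (inversions n w)"
  unfolding perm_length_def is_expression_def
proof (rule Least_equality)
  show "\<exists>ws. (set ws \<subseteq> {1..<n} \<and> word_perm ws = w) \<and> length ws = card (inversions n w)"
    using ex_word_of_inversion_length[OF assms] by blast
qed (use card_inversions_le_length in blast)

lemma reduced_tail:
  assumes "set (i # us) \<subseteq> {1..<n}" "word_perm (i # us) = w" "length (i # us) = card (inversions n w)"
  shows "inv w (i + 1) < inv w i" "word_perm us = transpose i (i + 1) \<circ> w"
    "length us = card (inversions n (transpose i (i + 1) \<circ> w))"
proof -
  have w: "w permutes {1..n}" and i: "i \<in> {1..<n}"
    using assms(1,2) word_perm_permutes[of "i # us" n] by auto
  show u: "word_perm us = transpose i (i + 1) \<circ> w"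
    using assms(2) by auto
  have le: "card (inversions n (transpose i (i + 1) \<circ> w)) \<le> length us"
    using card_inversions_le_length[of us n] assms(1) u by auto
  show d: "inv w (i + 1) < inv w i"
    using ascent_or_descent[OF w, of i] card_inversions_ascent[OF w i] le assms(3) by auto
  show "length us = card (inversions n (transpose i (i + 1) \<circ> w))"
    using card_inversions_descent[OF w i d] assms(3) by simp
qed

text \<open>
  Two reduced words of \<open>w\<close> with the same first letter are compared by induction. If the first letters
  \<open>i < j\<close> differ, both are descents of \<open>w\<close>, so \<open>w\<close> also has reduced words \<open>i j z\<close> and \<open>j i z\<close> with
  a common \<open>z\<close> (or \<open>i j i z\<close> and \<open>j i j z\<close> if the letters are adjacent). The induction hypothesis applies
  once to each side, and one commutation or braid relation joins the two.
\<close>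

theorem matsumoto:
  fixes f :: "nat \<Rightarrow> 'a::monoid_mult"
  assumes comm: "\<And>i j. i \<in> {1..<n} \<Longrightarrow> j \<in> {1..<n} \<Longrightarrow> i + 1 < j \<Longrightarrow> f i * f j = f j * f i"
    and braid: "\<And>i. i \<in> {1..<n} \<Longrightarrow> i + 1 \<in> {1..<n} \<Longrightarrow> f i * f (i + 1) * f i = f (i + 1) * f i * f (i + 1)"
    and us: "set us \<subseteq> {1..<n}" "word_perm us = w" "length us = card (inversions n w)"
    and vs: "set vs \<subseteq> {1..<n}" "word_perm vs = w" "length vs = card (inversions n w)"
  shows "prod_list (map f us) = prod_list (map f vs)"
  using us vs
proof (induction "length us" arbitrary: us vs w rule: less_induct)
  case (less us vs w)
  let ?s = "\<lambda>i. transpose i (i + 1) :: nat \<Rightarrow> nat"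
  have w: "w permutes {1..n}" using less.prems(1,2) word_perm_permutes by blast
  have main: "prod_list (map f (i # us')) = prod_list (map f (j # vs'))"
    if eq: "us = i # us'" "vs = j # vs'" and ij: "i < j"
      and IH: "\<And>us1 vs1 w. length us1 = length us' \<Longrightarrow> set us1 \<subseteq> {1..<n} \<Longrightarrow> word_perm us1 = w \<Longrightarrow> length us1 = card (inversions n w) \<Longrightarrow>
        set vs1 \<subseteq> {1..<n} \<Longrightarrow> word_perm vs1 = w \<Longrightarrow> length vs1 = card (inversions n w) \<Longrightarrow>
        prod_list (map f us1) = prod_list (map f vs1)"
      and us: "set us \<subseteq> {1..<n}" "word_perm us = w" "length us = card (inversions n w)"
      and vs: "set vs \<subseteq> {1..<n}" "word_perm vs = w" "length vs = card (inversions n w)"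
    for us vs us' vs' i j
  proof -
    have i: "i \<in> {1..<n}" and j: "j \<in> {1..<n}" using us vs eq by auto
    note di = reduced_tail[OF us[unfolded eq]] and dj = reduced_tail[OF vs[unfolded eq]]
    have wi: "?s i \<circ> w permutes {1..n}" and wj: "?s j \<circ> w permutes {1..n}"
      by (intro permutes_compose adjacent_transpose_permutes i j w)+
    have subs: "set us' \<subseteq> {1..<n}" "set vs' \<subseteq> {1..<n}" using us vs eq by auto
    have len: "length us' = length vs'" using us vs eq by auto
    show ?thesis
    proof (cases "j = i + 1")
      case False
      then have far: "i + 1 < j" using ij by auto
      let ?w = "?s j \<circ> (?s i \<circ> w)"
      have com: "?s j \<circ> (?s i \<circ> w) = ?s i \<circ> (?s j \<circ> w)"
        using far by (auto simp: fun_eq_iff transpose_def)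
      have w': "?w permutes {1..n}"
        by (intro permutes_compose adjacent_transpose_permutes i j w)
      obtain z where z: "set z \<subseteq> {1..<n}" "word_perm z = ?w" "length z = card (inversions n ?w)"
        using ex_word_of_inversion_length[OF w'] .
      have c1: "card (inversions n (?s i \<circ> w)) = Suc (card (inversions n ?w))"
        by (rule card_inversions_descent[OF wi j])
          (use far dj(1) in \<open>unfold inv_transpose_comp[OF w], simp add: transpose_def\<close>)
      have c2: "card (inversions n (?s j \<circ> w)) = card (inversions n (?s i \<circ> w))"
        using di(3) dj(3) len by simp
      have z': "word_perm (j # z) = ?s i \<circ> w" "word_perm (i # z) = ?s j \<circ> w"
        by (simp_all only: word_perm_Cons z(2) transpose_comp_cancel) (simp only: com transpose_comp_cancel)
      have len': "length (j # z) = card (inversions n (?s i \<circ> w))"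
          "length (i # z) = card (inversions n (?s j \<circ> w))"
        using c1 c2 z(3) by simp_all
      have sets: "set (j # z) \<subseteq> {1..<n}" "set (i # z) \<subseteq> {1..<n}"
        using z(1) i j by simp_all
      have "prod_list (map f us') = prod_list (map f (j # z))"
        by (rule IH[OF HOL.refl subs(1) di(2,3) sets(1) z'(1) len'(1)])
      moreover have "prod_list (map f vs') = prod_list (map f (i # z))"
        by (rule IH[OF len[symmetric] subs(2) dj(2,3) sets(2) z'(2) len'(2)])
      ultimately show ?thesis
        using comm[OF i j far] by (simp add: mult.assoc[symmetric])
    next
      case True
      let ?w1 = "?s j \<circ> (?s i \<circ> w)" and ?w2 = "?s i \<circ> (?s j \<circ> w)"
      let ?w = "?s i \<circ> ?w1"
      have br: "?s i \<circ> (?s j \<circ> (?s i \<circ> w)) = ?s j \<circ> (?s i \<circ> (?s j \<circ> w))"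
        using True by (auto simp: fun_eq_iff transpose_def)
      have p: "?w1 permutes {1..n}" "?w2 permutes {1..n}" "?w permutes {1..n}"
        by (intro permutes_compose adjacent_transpose_permutes i j w)+
      obtain z where z: "set z \<subseteq> {1..<n}" "word_perm z = ?w" "length z = card (inversions n ?w)"
        using ex_word_of_inversion_length[OF p(3)] .
      have d: "inv w (i + 2) < inv w (i + 1)" "inv w (i + 1) < inv w i"
        using di(1) dj(1) True by auto
      have c1: "card (inversions n (?s i \<circ> w)) = Suc (card (inversions n ?w1))"
        by (rule card_inversions_descent[OF wi j])
          (use d True in \<open>unfold inv_transpose_comp[OF w], simp add: transpose_def\<close>)
      have c2: "card (inversions n ?w1) = Suc (card (inversions n ?w))"
        by (rule card_inversions_descent[OF p(1) i])
          (use d True in \<open>unfold inv_transpose_comp[OF wi] inv_transpose_comp[OF w], simp add: transpose_def\<close>)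
      have c3: "card (inversions n (?s j \<circ> w)) = card (inversions n (?s i \<circ> w))"
        using di(3) dj(3) len by simp
      have z': "word_perm (j # i # z) = ?s i \<circ> w" "word_perm (i # j # z) = ?s j \<circ> w"
        by (simp_all only: word_perm_Cons z(2) transpose_comp_cancel) (simp only: br transpose_comp_cancel)
      have len': "length (j # i # z) = card (inversions n (?s i \<circ> w))"
          "length (i # j # z) = card (inversions n (?s j \<circ> w))"
        using c1 c2 c3 z(3) by simp_all
      have sets: "set (j # i # z) \<subseteq> {1..<n}" "set (i # j # z) \<subseteq> {1..<n}"
        using z(1) i j by simp_all
      have "prod_list (map f us') = prod_list (map f (j # i # z))"
        by (rule IH[OF HOL.refl subs(1) di(2,3) sets(1) z'(1) len'(1)])
      moreover have "prod_list (map f vs') = prod_list (map f (i # j # z))"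
        by (rule IH[OF len[symmetric] subs(2) dj(2,3) sets(2) z'(2) len'(2)])
      moreover have "f i * f j * f i = f j * f i * f j"
        using braid[OF i] j True by simp
      ultimately show ?thesis
        by (simp add: mult.assoc[symmetric])
    qed
  qed
  show ?case
  proof (cases us)
    case Nil
    then show ?thesis using less.prems by auto
  next
    case (Cons i us')
    then obtain j vs' where vs': "vs = j # vs'"
      using less.prems by (cases vs) auto
    have IH: "prod_list (map f us1) = prod_list (map f vs1)"
      if "length us1 = length us'" "set us1 \<subseteq> {1..<n}" "word_perm us1 = v" "length us1 = card (inversions n v)"
        "set vs1 \<subseteq> {1..<n}" "word_perm vs1 = v" "length vs1 = card (inversions n v)" for us1 vs1 v
      using less.hyps[of us1 v vs1] that Cons by auto
    consider "i = j" | "i < j" | "j < i" by linarith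
    then show ?thesis
    proof cases
      case 1
      note di = reduced_tail[OF less.prems(1-3)[unfolded Cons]]
        and dj = reduced_tail[OF less.prems(4-6)[unfolded vs']]
      have "prod_list (map f us') = prod_list (map f vs')"
        using IH[OF HOL.refl _ di(2,3) _ dj(2,3)[folded 1]] less.prems(1,4) Cons vs' by simp
      then show ?thesis using 1 Cons vs' by simp
    next
      case 2
      have "prod_list (map f (i # us')) = prod_list (map f (j # vs'))"
        by (rule main[OF Cons vs' 2 _ less.prems], rule IH; assumption)
      then show ?thesis by (simp only: Cons vs')
    next
      case 3
      have len: "length vs' = length us'"
        using less.prems(3,6) by (simp add: Cons vs')
      have "prod_list (map f (j # vs')) = prod_list (map f (i # us'))"
        by (rule main[OF vs' Cons 3 _ less.prems(4-6) less.prems(1-3)], rule IH[folded len]; assumption)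
      then show ?thesis by (simp only: Cons vs')
    qed
  qed
qed

section \<open>The longest permutation\<close>

definition reversal :: "nat \<Rightarrow> nat \<Rightarrow> nat"
  where "reversal n i = (if i \<in> {1..n} then n + 1 - i else i)"

lemma reversal_reversal [simp]: "reversal n (reversal n i) = i"
  by (auto simp: reversal_def)

lemma reversal_permutes: "reversal n permutes {1..n}"
  by (rule bij_imp_permutes[OF bij_betw_byWitness[where f' = "reversal n"]])
    (auto simp: reversal_def)

lemma inv_reversal [simp]: "inv (reversal n) = reversal n"
  by (rule inv_equality) simp_all

lemma longest_perm_permutes: "longest_perm n permutes {1..n}"
  and card_inversions_le_longest:
    "v permutes {1..n} \<Longrightarrow> card (inversions n v) \<le> card (inversions n (longest_perm n))"
proof -
  have le: "card (inversions n w) \<le> n * n" for w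
  proof -
    have "card (inversions n w) \<le> card ({1..n} \<times> {1..n})"
      by (rule card_mono) (auto simp: inversions_def)
    then show ?thesis by (simp add: card_cartesian_product)
  qed
  have bound: "\<forall>w. w permutes {1..n} \<longrightarrow> perm_length n w < Suc (n * n)"
    using le by (simp add: perm_length_eq_card_inversions less_Suc_eq_le)
  show *: "longest_perm n permutes {1..n}"
    unfolding longest_perm_def by (rule arg_max_natI[OF permutes_id bound])
  show "card (inversions n v) \<le> card (inversions n (longest_perm n))" if "v permutes {1..n}"
    using arg_max_nat_le[OF that bound, folded longest_perm_def]
    unfolding perm_length_eq_card_inversions[OF that] perm_length_eq_card_inversions[OF *] .
qed

lemma longest_perm_descent:
  assumes "r \<in> {1..<n}"
  shows "inv (longest_perm n) (r + 1) < inv (longest_perm n) r"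
proof (rule ccontr)
  assume "\<not> ?thesis"
  then have "inv (longest_perm n) r < inv (longest_perm n) (r + 1)"
    using ascent_or_descent[OF longest_perm_permutes] by blast
  from card_inversions_ascent[OF longest_perm_permutes assms this]
  show False
    using card_inversions_le_longest[of "transpose r (r + 1) \<circ> longest_perm n" n]
      permutes_compose[OF longest_perm_permutes adjacent_transpose_permutes[OF assms]]
    by simp
qed

text \<open>
  A permutation with the maximal number of inversions descends at every \<open>r\<close>, for otherwise
  \<open>inversions_ascent\<close> would lengthen it; only the reversal does that.
\<close>

lemma longest_perm_eq_reversal: "longest_perm n = reversal n"
proof -
  let ?p = "inv (longest_perm n)"
  have "?p \<circ> reversal n = id"
  proof (rule strict_increasing_permutes_id)
    show "?p \<circ> reversal n permutes {1..n}"
      by (intro permutes_compose reversal_permutes permutes_inv longest_perm_permutes)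
    show "(?p \<circ> reversal n) r < (?p \<circ> reversal n) (r + 1)" if "r \<in> {1..<n}" for r
      using longest_perm_descent[of "n - r" n] that by (auto simp: reversal_def Suc_diff_le)
  qed
  then have "?p (reversal n i) = i" for i
    by (simp add: fun_eq_iff)
  then have "reversal n i = longest_perm n i" for i
    using permutes_inverses(1)[OF longest_perm_permutes] by metis
  then show ?thesis by auto
qed

text \<open>
  The reduced word \<open>(1) (2 1) (3 2 1) \<dots> (n-1 \<dots> 2 1)\<close> of the longest permutation, split into descending
  runs because each run lowers a staircase of exponents by one step.
\<close>

fun staircase_word :: "nat \<Rightarrow> nat list"
  where
    "staircase_word 0 = []"
  | "staircase_word (Suc n) = staircase_word n @ rev [1..<n + 1]"

lemma set_staircase_word: "set (staircase_word n) \<subseteq> {1..<n}"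
  by (induction n) auto

lemma word_perm_descending_run:
  "word_perm (rev [1..<n + 1]) = (\<lambda>x. if x = 1 then n + 1 else if x \<in> {2..n + 1} then x - 1 else x)"
proof (induction n)
  case 0
  show ?case by (auto simp: fun_eq_iff)
next
  case (Suc n)
  have "rev [1..<Suc n + 1] = Suc n # rev [1..<n + 1]" by simp
  then have "word_perm (rev [1..<Suc n + 1]) =
      transpose (Suc n) (Suc n + 1) \<circ> word_perm (rev [1..<n + 1])"
    by (simp only: word_perm_Cons)
  then show ?case
    unfolding Suc by (auto simp: fun_eq_iff transpose_def)
qed

lemma word_perm_staircase: "word_perm (staircase_word n) = reversal n"
proof (induction n)
  case 0
  show ?case by (auto simp: fun_eq_iff reversal_def)
next
  case (Suc n)
  show ?case
    unfolding staircase_word.simps word_perm_append Suc word_perm_descending_run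
    by (auto simp: fun_eq_iff reversal_def)
qed

lemma length_staircase_word: "length (staircase_word n) = card (inversions n (reversal n))"
proof (induction n)
  case (Suc n)
  have "inversions (Suc n) (reversal (Suc n)) = inversions n (reversal n) \<union> {1..n} \<times> {Suc n}"
    by (auto simp: inversions_def reversal_def)
  moreover have "inversions n (reversal n) \<inter> {1..n} \<times> {Suc n} = {}"
    by (auto simp: inversions_def)
  ultimately show ?case
    using Suc by (simp add: card_Un_disjoint card_cartesian_product)
qed (auto simp: inversions_def)

section \<open>The element of the longest permutation\<close>

lemma nh_psi_square: "r \<in> {1..<CARD('n)} \<Longrightarrow> nh_psi r * nh_psi r = (0 :: ('k::field, 'n::finite) nilhecke)"
  by transfer (rule nh_cong.psi_square)

lemma nh_psi_comm:
  "r \<in> {1..<CARD('n)} \<Longrightarrow> k \<in> {1..<CARD('n)} \<Longrightarrow> \<bar>int r - int k\<bar> > 1 \<Longrightarrow>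
    nh_psi r * nh_psi k = (nh_psi k * nh_psi r :: ('k::field, 'n::finite) nilhecke)"
  by transfer (rule nh_cong.psi_comm)

lemma nh_psi_braid:
  "r \<in> {1..<CARD('n)} \<Longrightarrow> r + 1 \<in> {1..<CARD('n)} \<Longrightarrow>
    nh_psi r * nh_psi (r + 1) * nh_psi r =
      (nh_psi (r + 1) * nh_psi r * nh_psi (r + 1) :: ('k::field, 'n::finite) nilhecke)"
  by transfer (rule nh_cong.psi_braid)

lemma nh_y_comm:
  "r \<in> {1..CARD('n)} \<Longrightarrow> k \<in> {1..CARD('n)} \<Longrightarrow>
    nh_y r * nh_y k = (nh_y k * nh_y r :: ('k::field, 'n::finite) nilhecke)"
  by transfer (rule nh_cong.y_comm)

lemma nh_psi_y_Suc:
  "r \<in> {1..<CARD('n)} \<Longrightarrow>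
    nh_psi r * nh_y (r + 1) = (nh_y r * nh_psi r + 1 :: ('k::field, 'n::finite) nilhecke)"
  by transfer (rule nh_cong.psi_y_Suc)

lemma nh_psi_y:
  assumes "r \<in> {1..<CARD('n)}"
  shows "nh_psi r * nh_y r = (nh_y (r + 1) * nh_psi r - 1 :: ('k::field, 'n::finite) nilhecke)"
proof -
  have "nh_y (r + 1) * nh_psi r = (nh_psi r * nh_y r + 1 :: ('k, 'n) nilhecke)"
    using assms by transfer (rule nh_cong.y_Suc_psi)
  then show ?thesis by simp
qed

lemma nh_psi_y_comm:
  "r \<in> {1..<CARD('n)} \<Longrightarrow> k \<in> {1..CARD('n)} \<Longrightarrow> k \<noteq> r \<Longrightarrow> k \<noteq> r + 1 \<Longrightarrow>
    nh_psi r * nh_y k = (nh_y k * nh_psi r :: ('k::field, 'n::finite) nilhecke)"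
  by transfer (rule nh_cong.psi_y_comm)

abbreviation psi_longest :: "('k::field, 'n::finite) nilhecke"
  where "psi_longest \<equiv> psi_perm (longest_perm CARD('n))"

lemma psi_perm_reduced_word:
  assumes w: "w permutes {1..CARD('n)}"
    and ws: "set ws \<subseteq> {1..<CARD('n)}" "word_perm ws = w" "length ws = card (inversions CARD('n) w)"
  shows "(psi_perm w :: ('k::field, 'n::finite) nilhecke) = prod_list (map nh_psi ws)"
proof -
  have "is_reduced CARD('n) w (SOME ws. is_reduced CARD('n) w ws)"
    by (rule someI[of _ ws]) (use ws in \<open>simp add: is_reduced_iff[OF w]\<close>)
  note * = is_reduced_iff[OF w, THEN iffD1, OF this]
  show ?thesis
    unfolding psi_perm_def
  proof (rule matsumoto[where n = "CARD('n)" and w = w])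
    show "nh_psi i * nh_psi j = (nh_psi j * nh_psi i :: ('k, 'n) nilhecke)"
      if "i \<in> {1..<CARD('n)}" "j \<in> {1..<CARD('n)}" "i + 1 < j" for i j
      by (rule nh_psi_comm) (use that in auto)
  qed (use * ws nh_psi_braid in blast)+
qed

lemma psi_longest_word:
  assumes "set ws \<subseteq> {1..<CARD('n)}" "word_perm ws = reversal CARD('n)"
    "length ws = card (inversions CARD('n) (reversal CARD('n)))"
  shows "(psi_longest :: ('k::field, 'n::finite) nilhecke) = prod_list (map nh_psi ws)"
  unfolding longest_perm_eq_reversal
  by (rule psi_perm_reduced_word[OF reversal_permutes assms])

lemma psi_longest_staircase:
  "(psi_longest :: ('k::field, 'n::finite) nilhecke) =
    prod_list (map nh_psi (staircase_word CARD('n)))"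
  by (rule psi_longest_word[OF set_staircase_word word_perm_staircase length_staircase_word])

text \<open>
  A descent of the longest permutation gives a reduced word that starts with \<open>r\<close>. The longest permutation
  is an involution, so the reversed word is a reduced word of it as well, and that one ends with \<open>r\<close>.
\<close>

lemma psi_longest_factors:
  assumes r: "r \<in> {1..<CARD('n)}"
  obtains a b :: "('k::field, 'n::finite) nilhecke"
  where "psi_longest = nh_psi r * a" "psi_longest = b * nh_psi r"
proof -
  let ?n = "CARD('n)"
  let ?v = "transpose r (r + 1) \<circ> reversal ?n"
  have "inv (reversal ?n) (r + 1) < inv (reversal ?n) r"
    using longest_perm_descent[OF r] by (simp add: longest_perm_eq_reversal)
  from card_inversions_descent[OF reversal_permutes r this]
  have card: "card (inversions ?n (reversal ?n)) = Suc (card (inversions ?n ?v))" .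
  have v: "?v permutes {1..?n}"
    by (intro permutes_compose adjacent_transpose_permutes r reversal_permutes)
  obtain us where us: "set us \<subseteq> {1..<?n}" "word_perm us = ?v" "length us = card (inversions ?n ?v)"
    using ex_word_of_inversion_length[OF v] .
  have w: "word_perm (r # us) = reversal ?n"
    unfolding word_perm_Cons us by (rule transpose_comp_cancel)
  have "(psi_longest :: ('k, 'n) nilhecke) = prod_list (map nh_psi (r # us))"
    by (rule psi_longest_word) (use us r card w in \<open>simp_all del: word_perm_Cons\<close>)
  moreover have "(psi_longest :: ('k, 'n) nilhecke) = prod_list (map nh_psi (rev (r # us)))"
  proof (rule psi_longest_word)
    show "word_perm (rev (r # us)) = reversal ?n"
      by (simp only: word_perm_rev w inv_reversal)
  qed (use us r card in simp_all)
  ultimately show thesis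
    using that[of "prod_list (map nh_psi us)" "prod_list (map nh_psi (rev us))"] by simp
qed

lemma psi_mult_longest:
  assumes "r \<in> {1..<CARD('n)}"
  shows "nh_psi r * psi_longest = (0 :: ('k::field, 'n::finite) nilhecke)"
proof -
  obtain a b :: "('k, 'n) nilhecke"
    where a: "psi_longest = nh_psi r * a" "psi_longest = b * nh_psi r"
    using psi_longest_factors[OF assms] .
  show ?thesis
    unfolding a(1) using nh_psi_square[OF assms, where 'k = 'k] by (simp add: mult.assoc[symmetric])
qed

section \<open>The commutative subring generated by the polynomial generators\<close>

inductive_set y_subring :: "('k::field, 'n::finite) nilhecke set" where
  zero: "0 \<in> y_subring"
| one: "1 \<in> y_subring"
| gen: "i \<in> {1..CARD('n)} \<Longrightarrow> nh_y i \<in> y_subring"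
| diff: "a \<in> y_subring \<Longrightarrow> b \<in> y_subring \<Longrightarrow> a - b \<in> y_subring"
| mult: "a \<in> y_subring \<Longrightarrow> b \<in> y_subring \<Longrightarrow> a * b \<in> y_subring"

lemma y_subring_minus: "a \<in> y_subring \<Longrightarrow> - a \<in> y_subring"
  using y_subring.diff[OF y_subring.zero, of a] by simp

lemma y_subring_add: "a \<in> y_subring \<Longrightarrow> b \<in> y_subring \<Longrightarrow> a + b \<in> y_subring"
  using y_subring.diff[of a "- b"] y_subring_minus[of b] by simp

lemma y_subring_commute:
  assumes "a \<in> y_subring" "b \<in> y_subring"
  shows "a * b = (b * a :: ('k::field, 'n::finite) nilhecke)"
proof -
  have commute_if_gen: "a * c = c * a"
    if "\<And>i. i \<in> {1..CARD('n)} \<Longrightarrow> nh_y i * c = c * nh_y i" "a \<in> y_subring"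
    for a c :: "('k, 'n) nilhecke"
    using that(2)
  proof induction
    case (mult a b)
    then show ?case by (metis mult.assoc)
  qed (use that(1) in \<open>simp_all add: algebra_simps\<close>)
  have "nh_y i * b = b * nh_y i" if i: "i \<in> {1..CARD('n)}" for i
    using commute_if_gen[OF _ assms(2), of "nh_y i"] nh_y_comm i by metis
  then show ?thesis
    using commute_if_gen assms(1) by blast
qed

text \<open>
  The determinant calculus below is stated for rings with \<open>0 \<noteq> 1\<close>. The integer component of a pair
  provides this without a proof that the nilHecke algebra is nonzero; the product of the two rings
  projects onto the subring by a ring homomorphism, and only this projection is observed later.
\<close>

typedef (overloaded) ('k, 'n) ypoly =
  "(y_subring :: ('k::field, 'n::finite) nilhecke set) \<times> (UNIV :: int set)"
  using y_subring.zero by auto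

setup_lifting type_definition_ypoly

instantiation ypoly :: (field, finite) comm_ring_1
begin

lift_definition zero_ypoly :: "('a, 'b) ypoly" is "(0, 0)"
  by (simp add: y_subring.zero)
lift_definition one_ypoly :: "('a, 'b) ypoly" is "(1, 1)"
  by (simp add: y_subring.one)
lift_definition plus_ypoly :: "('a, 'b) ypoly \<Rightarrow> ('a, 'b) ypoly \<Rightarrow> ('a, 'b) ypoly"
  is "\<lambda>p q. (fst p + fst q, snd p + snd q)"
  by (auto intro: y_subring_add)
lift_definition uminus_ypoly :: "('a, 'b) ypoly \<Rightarrow> ('a, 'b) ypoly"
  is "\<lambda>p. (- fst p, - snd p)"
  by (auto intro: y_subring_minus)
lift_definition minus_ypoly :: "('a, 'b) ypoly \<Rightarrow> ('a, 'b) ypoly \<Rightarrow> ('a, 'b) ypoly"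
  is "\<lambda>p q. (fst p - fst q, snd p - snd q)"
  by (auto intro: y_subring.diff)
lift_definition times_ypoly :: "('a, 'b) ypoly \<Rightarrow> ('a, 'b) ypoly \<Rightarrow> ('a, 'b) ypoly"
  is "\<lambda>p q. (fst p * fst q, snd p * snd q)"
  by (auto intro: y_subring.mult)

instance
  by standard (transfer; auto simp: algebra_simps intro: y_subring_commute)+

end

definition ypoly_val :: "('k::field, 'n::finite) ypoly \<Rightarrow> ('k, 'n) nilhecke"
  where "ypoly_val f = fst (Rep_ypoly f)"

lift_definition yvar :: "nat \<Rightarrow> ('k::field, 'n::finite) ypoly"
  is "\<lambda>i. if i \<in> {1..CARD('n)} then (nh_y i, 0) else (0, 0)"
  by (auto intro: y_subring.intros)

lemma ypoly_val_simps [simp]: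
  "ypoly_val 0 = 0" "ypoly_val 1 = 1" "ypoly_val (a + b) = ypoly_val a + ypoly_val b"
  "ypoly_val (a - b) = ypoly_val a - ypoly_val b" "ypoly_val (- a) = - ypoly_val a"
  "ypoly_val (a * b) = ypoly_val a * ypoly_val b"
  by (simp_all add: ypoly_val_def zero_ypoly.rep_eq one_ypoly.rep_eq plus_ypoly.rep_eq
      minus_ypoly.rep_eq uminus_ypoly.rep_eq times_ypoly.rep_eq)

lemma ypoly_val_yvar [simp]: "i \<in> {1..CARD('n)} \<Longrightarrow> ypoly_val (yvar i :: ('k::field, 'n::finite) ypoly) = nh_y i"
  by (simp add: ypoly_val_def yvar.rep_eq)

lemma ypoly_val_sum: "ypoly_val (sum f A) = (\<Sum>x\<in>A. ypoly_val (f x))"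
  by (induction A rule: infinite_finite_induct) simp_all

lemma ypoly_val_power: "ypoly_val (a ^ k) = ypoly_val a ^ k"
  by (induction k) simp_all

lemma ypoly_val_prod_list: "ypoly_val (prod_list xs) = prod_list (map ypoly_val xs)"
  by (induction xs) simp_all

lemma ypoly_val_commute: "ypoly_val a * ypoly_val b = ypoly_val b * ypoly_val a"
  by (metis ypoly_val_simps(6) mult.commute)

section \<open>Leibniz determinants over commutative rings\<close>

lemma prod_list_map_upt:
  fixes f :: "nat \<Rightarrow> 'a::comm_monoid_mult"
  shows "prod_list (map f [1..<m + 1]) = (\<Prod>i = 1..m. f i)"
proof -
  have "{1..m} = set [1..<m + 1]" by auto
  then show ?thesis by (simp only: prod.distinct_set_conv_list distinct_upt)
qed

lemma leibniz_det_prod: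
  fixes A :: "nat \<Rightarrow> nat \<Rightarrow> 'a::comm_ring_1"
  shows "leibniz_det m A =
    (\<Sum>\<sigma> | \<sigma> permutes {1..m}. (if evenperm \<sigma> then 1 else - 1) * (\<Prod>i = 1..m. A i (\<sigma> i)))"
  unfolding leibniz_det_def prod_list_map_upt ..

lemma evenperm_map_permutation:
  assumes "finite A" "p permutes A" "inj_on f A"
  shows "evenperm (map_permutation A f p) = evenperm p"
  using assms(2,1)
proof (induction rule: permutes_induct)
  case id
  then show ?case using assms(3) by (simp add: map_permutation_ident')
next
  case (swap a b p)
  have "map_permutation A f p permutes f ` A"
    by (rule map_permutation_permutes[OF inj_on_imp_bij_betw[OF assms(3)] swap.hyps(4)])
  then have q: "permutation (map_permutation A f p)"
    using assms(1) permutation_permutes by blast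
  have p: "permutation p"
    using swap.hyps(4) assms(1) permutation_permutes by blast
  have "map_permutation A f (transpose a b \<circ> p) = transpose (f a) (f b) \<circ> map_permutation A f p"
    using map_permutation_compose'[OF assms(3) swap.hyps(4)] map_permutation_transpose[OF assms(3) swap.hyps(1,2)]
    by simp
  moreover have "f a \<noteq> f b"
    using swap.hyps(1-3) assms(3) by (auto dest: inj_onD)
  ultimately show ?case
    using swap.hyps(3) swap.IH p q by (simp only: evenperm_comp permutation_swap_id evenperm_swap)
qed

text \<open>
  The only difference between the two determinants is whether indices are counted from \<open>1\<close> or from \<open>0\<close>.
\<close>

lemma leibniz_det_eq_det:
  fixes A :: "nat \<Rightarrow> nat \<Rightarrow> 'a::comm_ring_1"
  shows "leibniz_det m A = det (mat m m (\<lambda>(i, j). A (i + 1) (j + 1)))"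
proof -
  let ?up = "map_permutation {0..<m} Suc" and ?down = "map_permutation {1..m} (\<lambda>i. i - 1)"
  have up: "bij_betw Suc {0..<m} {1..m}"
    by (rule bij_betw_byWitness[where f' = "\<lambda>i. i - 1"]) auto
  have down: "bij_betw (\<lambda>i. i - 1) {1..m} {0..<m}"
    by (rule bij_betw_byWitness[where f' = Suc]) auto
  have "(\<Sum>p | p permutes {0..<m}. signof p * (\<Prod>i = 0..<m. A (i + 1) (p i + 1))) =
      (\<Sum>\<sigma> | \<sigma> permutes {1..m}. (if evenperm \<sigma> then 1 else - 1) * (\<Prod>i = 1..m. A i (\<sigma> i)))"
  proof (rule sum.reindex_bij_witness[of _ ?down ?up])
    fix p assume "p \<in> {p. p permutes {0..<m}}"
    then have p: "p permutes {0..<m}" by simp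
    show "?down (?up p) = p"
      by (rule map_permutation_compose_inv[OF up p]) simp
    show "?up p \<in> {\<sigma>. \<sigma> permutes {1..m}}"
      using map_permutation_permutes[OF up p] by simp
    have "(\<Prod>i = 1..m. A i (?up p i)) = (\<Prod>i = 0..<m. A (Suc i) (?up p (Suc i)))"
      by (rule prod.reindex_bij_betw[OF up, symmetric])
    also have "\<dots> = (\<Prod>i = 0..<m. A (i + 1) (p i + 1))"
      by (rule prod.cong) (simp_all add: map_permutation_apply)
    finally show "(if evenperm (?up p) then 1 else - 1) * (\<Prod>i = 1..m. A i (?up p i)) =
        signof p * (\<Prod>i = 0..<m. A (i + 1) (p i + 1))"
      using evenperm_map_permutation[OF _ p, of Suc] by (simp add: sign_def)
  next
    fix \<sigma> assume "\<sigma> \<in> {\<sigma>. \<sigma> permutes {1..m}}"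
    then have \<sigma>: "\<sigma> permutes {1..m}" by simp
    show "?up (?down \<sigma>) = \<sigma>"
      by (rule map_permutation_compose_inv[OF down \<sigma>]) simp
    show "?down \<sigma> \<in> {p. p permutes {0..<m}}"
      using map_permutation_permutes[OF down \<sigma>] by simp
  qed
  moreover have "(\<Prod>i = 0..<m. mat m m (\<lambda>(i, j). A (i + 1) (j + 1)) $$ (i, p i)) =
      (\<Prod>i = 0..<m. A (i + 1) (p i + 1))" if "p permutes {0..<m}" for p
    by (rule prod.cong) (use permutes_in_image[OF that] in auto)
  ultimately show ?thesis
    unfolding leibniz_det_prod by (simp add: det_def'[of _ m])
qed

section \<open>Complementary minors\<close>

lemma det_identity_right_block:
  fixes A :: "'a::comm_ring_1 mat"
  assumes "A \<in> carrier_mat n n" "C \<in> carrier_mat m n"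
  shows "det (four_block_mat A (0\<^sub>m n m) C (1\<^sub>m m)) = det A"
  using assms(2)
proof (induction m arbitrary: C)
  case 0
  have "four_block_mat A (0\<^sub>m n 0) C (1\<^sub>m 0) = A"
    using assms 0 by (intro eq_matI) auto
  then show ?case by simp
next
  case (Suc m)
  let ?C = "mat m n (\<lambda>(i, j). C $$ (i, j))"
  let ?X = "four_block_mat A (0\<^sub>m n m) ?C (1\<^sub>m m)"
  let ?R = "mat 1 (n + m) (\<lambda>(i, j). if j < n then C $$ (m, j) else 0)"
  have "four_block_mat A (0\<^sub>m n (Suc m)) C (1\<^sub>m (Suc m)) =
      four_block_mat ?X (0\<^sub>m (n + m) 1) ?R (1\<^sub>m 1)"
    using assms(1) Suc.prems by (intro eq_matI) (auto simp: less_Suc_eq, simp_all)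
  also have "det \<dots> = det ?X * det (1\<^sub>m 1 :: 'a mat)"
    by (rule det_four_block_mat_upper_right_zero_col) (use assms(1) in auto)
  also have "det ?X = det A"
    by (rule Suc.IH) simp
  finally show ?case by simp
qed

lemma det_identity_left_block:
  fixes D :: "'a::comm_ring_1 mat"
  assumes "D \<in> carrier_mat m m" "B \<in> carrier_mat n m"
  shows "det (four_block_mat (1\<^sub>m n) B (0\<^sub>m m n) D) = det D"
  using assms(2)
proof (induction n arbitrary: B)
  case 0
  have "four_block_mat (1\<^sub>m 0) B (0\<^sub>m m 0) D = D"
    using assms 0 by (intro eq_matI) auto
  then show ?case by simp
next
  case (Suc n)
  let ?B = "mat n m (\<lambda>(i, j). B $$ (Suc i, j))"
  let ?X = "four_block_mat (1\<^sub>m n) ?B (0\<^sub>m m n) D"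
  let ?R = "mat 1 (n + m) (\<lambda>(i, j). if j < n then 0 else B $$ (0, j - n))"
  have "four_block_mat (1\<^sub>m (Suc n)) B (0\<^sub>m m (Suc n)) D =
      four_block_mat (1\<^sub>m 1) ?R (0\<^sub>m (n + m) 1) ?X"
    using assms(1) Suc.prems by (intro eq_matI) (auto simp: less_Suc_eq_0_disj Suc_diff_le)
  also have "det \<dots> = det (1\<^sub>m 1 :: 'a mat) * det ?X"
    by (rule det_four_block_mat_lower_left_zero_col) (use assms(1) in auto)
  also have "det ?X = det D"
    by (rule Suc.IH) simp
  finally show ?case by simp
qed

text \<open>
  Write \<open>M\<close> and \<open>N\<close> in blocks. Since \<open>M N = 1\<close>, the second block column of \<open>N\<close> yields
  \<open>M [[1, N\<^sub>1\<^sub>2], [0, N\<^sub>2\<^sub>2]] = [[M\<^sub>1\<^sub>1, 0], [M\<^sub>2\<^sub>1, 1]]\<close>; take determinants. The two block triangular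
  determinants are peeled off along the identity block, which works over any commutative ring.
\<close>

lemma jacobi_complementary_minor:
  fixes M N :: "'a::comm_ring_1 mat"
  assumes M: "M \<in> carrier_mat (n + m) (n + m)" and N: "N \<in> carrier_mat (n + m) (n + m)"
    and MN: "M * N = 1\<^sub>m (n + m)"
  shows "det (mat n n (\<lambda>(i, j). M $$ (i, j))) = det M * det (mat m m (\<lambda>(i, j). N $$ (n + i, n + j)))"
proof -
  let ?A = "mat n n (\<lambda>(i, j). M $$ (i, j))" and ?C = "mat m n (\<lambda>(i, j). M $$ (n + i, j))"
  let ?B = "mat n m (\<lambda>(i, j). N $$ (i, n + j))" and ?D = "mat m m (\<lambda>(i, j). N $$ (n + i, n + j))"
  let ?K = "four_block_mat (1\<^sub>m n) ?B (0\<^sub>m m n) ?D"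
  have K: "?K \<in> carrier_mat (n + m) (n + m)" by simp
  have "M * ?K = four_block_mat ?A (0\<^sub>m n m) ?C (1\<^sub>m m)"
  proof (rule eq_matI)
    fix i j
    assume "i < dim_row (four_block_mat ?A (0\<^sub>m n m) ?C (1\<^sub>m m))"
      and "j < dim_col (four_block_mat ?A (0\<^sub>m n m) ?C (1\<^sub>m m))"
    then have ij: "i < n + m" "j < n + m" by simp_all
    show "(M * ?K) $$ (i, j) = four_block_mat ?A (0\<^sub>m n m) ?C (1\<^sub>m m) $$ (i, j)"
    proof (cases "j < n")
      case True
      have "(M * ?K) $$ (i, j) = (\<Sum>k<n + m. M $$ (i, k) * ?K $$ (k, j))"
        using M ij by (simp add: scalar_prod_def atLeast0LessThan)
      also have "\<dots> = (\<Sum>k<n + m. if k = j then M $$ (i, j) else 0)"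
        by (rule sum.cong) (use True in auto)
      finally show ?thesis
        using ij True by auto
    next
      case False
      have "(M * ?K) $$ (i, j) = (\<Sum>k<n + m. M $$ (i, k) * ?K $$ (k, j))"
        using M ij by (simp add: scalar_prod_def atLeast0LessThan)
      also have "\<dots> = (\<Sum>k<n + m. M $$ (i, k) * N $$ (k, j))"
        by (rule sum.cong) (use False ij in auto)
      also have "\<dots> = (M * N) $$ (i, j)"
        using M N ij by (simp add: scalar_prod_def atLeast0LessThan)
      finally show ?thesis
        using ij False by (auto simp: MN)
    qed
  qed (use M in auto)
  then have "det M * det ?K = det (four_block_mat ?A (0\<^sub>m n m) ?C (1\<^sub>m m))"
    using det_mult[OF M K] by simp
  then show ?thesis
    by (simp add: det_identity_right_block det_identity_left_block)
qed

section \<open>Partitions and their conjugates\<close>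

lemma partitionsD:
  assumes "lam \<in> partitions n"
  shows "1 \<le> i \<Longrightarrow> i \<le> j \<Longrightarrow> lam j \<le> lam i" "i \<notin> {1..n} \<Longrightarrow> lam i = 0"
  using assms unfolding partitions_def by blast+

lemma partition_column:
  assumes lam: "lam \<in> partitions n" and k: "k \<ge> 1"
  shows "{j. k \<le> lam j} = {1..conjugate lam k}"
proof -
  have "j \<in> {1..n}" if "k \<le> lam j" for j
    using partitionsD(2)[OF lam, of j] that k by (cases "j \<in> {1..n}") simp_all
  then have fin: "finite {j. k \<le> lam j}"
    by (intro finite_subset[OF subsetI finite_atLeastAtMost]) (erule CollectE)
  have down: "i \<in> {j. k \<le> lam j}" if "j \<in> {j. k \<le> lam j}" "1 \<le> i" "i \<le> j" for i j
    using partitionsD(1)[OF lam that(2,3)] that(1) by auto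
  have pos: "j \<ge> 1" if "k \<le> lam j" for j
    using partitionsD(2)[OF lam, of j] that k by (cases "j = 0") simp_all
  have "\<exists>c. {j. k \<le> lam j} = {1..c}"
  proof (cases "{j. k \<le> lam j} = {}")
    case False
    then have "Max {j. k \<le> lam j} \<in> {j. k \<le> lam j}"
      using fin by (rule Max_in[rotated])
    then have "i \<in> {j. k \<le> lam j}" if "i \<in> {1..Max {j. k \<le> lam j}}" for i
      using down[of "Max {j. k \<le> lam j}" i] that by simp
    moreover have "i \<in> {1..Max {j. k \<le> lam j}}" if "i \<in> {j. k \<le> lam j}" for i
      using Max_ge[OF fin that] pos that by simp
    ultimately have "{j. k \<le> lam j} = {1..Max {j. k \<le> lam j}}" by blast
    then show ?thesis ..
  next
    case True
    then show ?thesis by (intro exI[of _ 0]) simp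
  qed
  then obtain c where c: "{j. k \<le> lam j} = {1..c}" ..
  then have "conjugate lam k = c"
    using k by (simp add: conjugate_def)
  then show ?thesis using c by simp
qed

text \<open>
  Both sides say that the box in row \<open>j\<close> and column \<open>k\<close> belongs to the diagram. This equivalence determines
  the conjugate partition and is the form in which it is used.
\<close>

lemma le_conjugate_iff:
  assumes lam: "lam \<in> partitions n" and "k \<ge> 1" "j \<ge> 1"
  shows "j \<le> conjugate lam k \<longleftrightarrow> k \<le> lam j"
proof -
  have "j \<in> {j. k \<le> lam j} \<longleftrightarrow> j \<in> {1..conjugate lam k}"
    using partition_column[OF lam assms(2)] by simp
  then show ?thesis using assms(3) by simp
qed

lemma conjugate_le:
  assumes "lam \<in> partitions n"
  shows "conjugate lam k \<le> n"
proof (rule ccontr)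
  assume "\<not> ?thesis"
  moreover from this have "k \<ge> 1" by (auto simp: conjugate_def split: if_splits)
  ultimately have "k \<le> lam (n + 1)"
    using le_conjugate_iff[OF assms, of k "n + 1"] by simp
  then show False using partitionsD(2)[OF assms, of "n + 1"] \<open>k \<ge> 1\<close> by simp
qed

lemma part_length_conjugate:
  assumes "lam \<in> partitions n"
  shows "part_length (conjugate lam) = lam 1"
proof -
  have "{k. conjugate lam k \<noteq> 0} = {1..lam 1}"
  proof (rule Set.set_eqI)
    fix k
    show "k \<in> {k. conjugate lam k \<noteq> 0} \<longleftrightarrow> k \<in> {1..lam 1}"
      using le_conjugate_iff[OF assms, of k 1] by (cases "k = 0") (auto simp: conjugate_def)
  qed
  then show ?thesis by (simp add: part_length_def)
qed

section \<open>Equality of the row and column determinants\<close>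

text \<open>
  Extension of the coefficient sequence by \<open>0\<close> to negative indices, as in \<open>h\<^sub>z = 0\<close> for \<open>z < 0\<close>.
\<close>

definition fps_coeff :: "'a::zero fps \<Rightarrow> int \<Rightarrow> 'a"
  where "fps_coeff F z = (if z < 0 then 0 else fps_nth F (nat z))"

lemma fps_coeff_simps [simp]: "z < 0 \<Longrightarrow> fps_coeff F z = 0" "fps_coeff F (int k) = fps_nth F k"
  "fps_coeff F 0 = fps_nth F 0"
  by (simp_all add: fps_coeff_def)

lemma fps_coeff_convolution:
  fixes F G :: "'a::comm_ring_1 fps"
  assumes "F * G = 1" and "r < N"
  shows "(\<Sum>z<N. fps_coeff F (int r - int z) * fps_coeff G (int z - int c)) = (if r = c then 1 else 0)"
proof (cases "c \<le> r")
  case True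
  have "(\<Sum>z<N. fps_coeff F (int r - int z) * fps_coeff G (int z - int c)) =
      (\<Sum>z\<in>{c..r}. fps_coeff F (int r - int z) * fps_coeff G (int z - int c))"
    using assms(2) by (intro sum.mono_neutral_right) auto
  also have "\<dots> = (\<Sum>k = 0..r - c. fps_nth G k * fps_nth F (r - c - k))"
    by (rule sum.reindex_bij_witness[of _ "\<lambda>k. k + c" "\<lambda>z. z - c"])
      (use True in \<open>auto simp: fps_coeff_def nat_diff_distrib' algebra_simps of_nat_diff\<close>)
  also have "\<dots> = fps_nth (G * F) (r - c)"
    by (simp add: fps_mult_nth)
  also have "G * F = 1"
    using assms(1) by (simp add: mult.commute)
  finally show ?thesis using True by auto
next
  case False
  have "(\<Sum>z<N. fps_coeff F (int r - int z) * fps_coeff G (int z - int c)) = 0"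
    by (intro sum.neutral ballI) (use False in \<open>auto simp: fps_coeff_def\<close>)
  then show ?thesis using False by auto
qed

text \<open>
  The first \<open>n\<close> values are the strictly decreasing numbers \<open>\<lambda>\<^sub>i + n - i\<close>, the others the strictly
  increasing numbers \<open>n - 1 + j - \<lambda>'\<^sub>j\<close>. Together they exhaust \<open>{0, \<dots>, n + m - 1}\<close> if \<open>\<lambda>\<close> fits into
  an \<open>n \<times> m\<close> rectangle. These are the complementary sets of rows that select the two minors of the Toeplitz matrix.
\<close>

definition partition_positions :: "nat \<Rightarrow> (nat \<Rightarrow> nat) \<Rightarrow> nat \<Rightarrow> nat"
  where "partition_positions n lam x =
    (if x < n then lam (x + 1) + n - 1 - x else x - conjugate lam (x - n + 1))"

lemma partition_positions_less:
  assumes lam: "lam \<in> partitions n" and "lam 1 \<le> m" "x < n + m"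
  shows "partition_positions n lam x < n + m"
  using partitionsD(1)[OF lam, of 1 "x + 1"] assms by (auto simp: partition_positions_def)

text \<open>
  Equality between a value of the first kind and one of the second kind would mean
  \<open>\<lambda>\<^sub>i + \<lambda>'\<^sub>j = i + j - 1\<close>, but the left side is at least \<open>i + j\<close> if the box \<open>(i, j)\<close> is in the diagram
  and at most \<open>i + j - 2\<close> if it is not.
\<close>

lemma partition_positions_inj:
  assumes lam: "lam \<in> partitions n"
  shows "inj (partition_positions n lam)"
proof (rule linorder_injI)
  fix x y :: nat
  assume xy: "x < y"
  show "partition_positions n lam x \<noteq> partition_positions n lam y"
  proof -
    consider "y < n" | "x < n" "n \<le> y" | "n \<le> x" using xy by linarith
    then show ?thesis
    proof cases
      case 1
      then show ?thesis
        using xy partitionsD(1)[OF lam, of "x + 1" "y + 1"] by (auto simp: partition_positions_def)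
    next
      case 2
      let ?i = "x + 1" and ?j = "y - n + 1"
      have "?j \<le> lam ?i \<and> ?i \<le> conjugate lam ?j \<or> lam ?i < ?j \<and> conjugate lam ?j < ?i"
        using le_conjugate_iff[OF lam, of ?j ?i] by linarith
      then show ?thesis
        using 2 conjugate_le[OF lam, of ?j] by (auto simp: partition_positions_def)
    next
      case 3
      have "conjugate lam (y - n + 1) \<le> conjugate lam (x - n + 1)"
      proof (cases "conjugate lam (y - n + 1) = 0")
        case False
        then have "y - n + 1 \<le> lam (conjugate lam (y - n + 1))"
          using le_conjugate_iff[OF lam, of "y - n + 1" "conjugate lam (y - n + 1)"] by simp
        then have "x - n + 1 \<le> lam (conjugate lam (y - n + 1))"
          using xy by linarith
        then show ?thesis
          using le_conjugate_iff[OF lam, of "x - n + 1" "conjugate lam (y - n + 1)"] False by simp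
      qed simp
      then show ?thesis
        using 3 xy conjugate_le[OF lam, of "x - n + 1"] by (auto simp: partition_positions_def)
    qed
  qed
qed

text \<open>
  The lower triangular Toeplitz matrix of a power series with its rows listed in the order prescribed by
  \<open>\<lambda>\<close>. The columns are listed in the order of the empty partition, so that a simultaneous permutation of
  rows and columns remains for \<open>\<lambda> = 0\<close>.
\<close>

definition toeplitz_rows :: "nat \<Rightarrow> nat \<Rightarrow> 'a::comm_ring_1 fps \<Rightarrow> (nat \<Rightarrow> nat) \<Rightarrow> 'a mat"
  where "toeplitz_rows n m F lam = mat (n + m) (n + m) (\<lambda>(x, z).
    fps_coeff F (int (partition_positions n lam x) - int (partition_positions n (\<lambda>_. 0) z)))"

lemma conjugate_zero [simp]: "conjugate (\<lambda>_. 0) k = 0"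
  by (auto simp: conjugate_def)

lemma zero_partition: "(\<lambda>_. 0) \<in> partitions n"
  by (simp add: partitions_def)

lemma toeplitz_rows_right_inverse:
  fixes F G :: "'a::comm_ring_1 fps"
  assumes lam: "lam \<in> partitions n" "lam 1 \<le> m" and FG: "F * G = 1"
  shows "toeplitz_rows n m F lam * mat (n + m) (n + m) (\<lambda>(z, y).
    fps_coeff G (int (partition_positions n (\<lambda>_. 0) z) - int (partition_positions n lam y))) = 1\<^sub>m (n + m)"
    (is "?M * ?N = _")
proof (rule eq_matI)
  fix x y
  assume "x < dim_row (1\<^sub>m (n + m) :: 'a mat)" "y < dim_col (1\<^sub>m (n + m) :: 'a mat)"
  then have xy: "x < n + m" "y < n + m" by simp_all
  let ?p = "partition_positions n lam" and ?q = "partition_positions n (\<lambda>_. 0)"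
  \<comment> \<open>the columns run through all indices once, so the sum over columns is a convolution\<close>
  have "?q ` {..<n + m} \<subseteq> {..<n + m}"
    using partition_positions_less[OF zero_partition, of m _ n] by auto
  then have bij: "bij_betw ?q {..<n + m} {..<n + m}"
    using inj_on_subset[OF partition_positions_inj[OF zero_partition]]
    by (intro bij_betw_imageI endo_inj_surj) auto
  have "(?M * ?N) $$ (x, y) =
      (\<Sum>z<n + m. fps_coeff F (int (?p x) - int (?q z)) * fps_coeff G (int (?q z) - int (?p y)))"
    using xy by (simp add: scalar_prod_def atLeast0LessThan toeplitz_rows_def)
  also have "\<dots> = (\<Sum>z<n + m. fps_coeff F (int (?p x) - int z) * fps_coeff G (int z - int (?p y)))"
    by (rule sum.reindex_bij_betw[OF bij])
  also have "\<dots> = (if ?p x = ?p y then 1 else 0)"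
    by (rule fps_coeff_convolution[OF FG partition_positions_less[OF lam xy(1)]])
  also have "?p x = ?p y \<longleftrightarrow> x = y"
    using partition_positions_inj[OF lam(1)] by (auto dest: injD)
  finally show "(?M * ?N) $$ (x, y) = 1\<^sub>m (n + m) $$ (x, y)"
    using xy by simp
qed (simp_all add: toeplitz_rows_def)

text \<open>
  In the first diagonal block the differences of the listed positions are \<open>\<lambda>\<^sub>i - i + j\<close>, in the second block of the
  inverse they are \<open>\<lambda>'\<^sub>j - j + i\<close>, so the second minor appears transposed.
\<close>

lemma jacobi_trudi_minors:
  fixes F G :: "'a::comm_ring_1 fps"
  assumes lam: "lam \<in> partitions n" "lam 1 \<le> m" and FG: "F * G = 1"
  shows "det (mat n n (\<lambda>(i, j). fps_coeff F (int (lam (i + 1)) - int i + int j))) =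
    det (toeplitz_rows n m F lam) *
    det (mat m m (\<lambda>(i, j). fps_coeff G (int (conjugate lam (i + 1)) - int i + int j)))"
    (is "det ?A = _ * det ?D")
proof -
  let ?M = "toeplitz_rows n m F lam"
  let ?N = "mat (n + m) (n + m) (\<lambda>(z, y).
    fps_coeff G (int (partition_positions n (\<lambda>_. 0) z) - int (partition_positions n lam y)))"
  have "det (mat n n (\<lambda>(i, j). ?M $$ (i, j))) = det ?M * det (mat m m (\<lambda>(i, j). ?N $$ (n + i, n + j)))"
    by (rule jacobi_complementary_minor[OF _ _ toeplitz_rows_right_inverse[OF lam FG]])
      (simp_all add: toeplitz_rows_def)
  also have "mat n n (\<lambda>(i, j). ?M $$ (i, j)) = ?A"
    by (rule eq_matI) (auto simp: toeplitz_rows_def partition_positions_def of_nat_diff algebra_simps)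
  also have "mat m m (\<lambda>(i, j). ?N $$ (n + i, n + j)) = transpose_mat ?D"
  proof (rule eq_matI)
    fix i j
    assume "i < dim_row (transpose_mat ?D)" "j < dim_col (transpose_mat ?D)"
    then have ij: "i < m" "j < m" by simp_all
    have "int (n + j - conjugate lam (j + 1)) = int n + int j - int (conjugate lam (j + 1))"
      using conjugate_le[OF lam(1), of "j + 1"] by (simp add: of_nat_diff)
    then show "mat m m (\<lambda>(i, j). ?N $$ (n + i, n + j)) $$ (i, j) = transpose_mat ?D $$ (i, j)"
      using ij by (simp add: partition_positions_def algebra_simps)
  qed simp_all
  also have "det (transpose_mat ?D) = det ?D"
    by (rule det_transpose[of _ m]) simp
  finally show ?thesis .
qed

lemma det_fps_coeff_unitriangular:
  assumes "fps_nth F 0 = 1"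
  shows "det (mat n n (\<lambda>(i, j). fps_coeff F (int j - int i))) = (1 :: 'a::comm_ring_1)"
proof -
  let ?A = "mat n n (\<lambda>(i, j). fps_coeff F (int j - int i))"
  have "det ?A = prod_list (diag_mat ?A)"
    by (rule det_upper_triangular) (auto intro: upper_triangularI)
  also have "diag_mat ?A = map (\<lambda>_. 1) [0..<n]"
    using assms by (simp add: diag_mat_def)
  finally show ?thesis by (simp add: map_replicate_const)
qed

text \<open>
  For the empty partition both minors in \<open>jacobi_trudi_minors\<close> are unitriangular, which leaves no other
  value for the factor between them.
\<close>

lemma det_toeplitz_rows_empty:
  fixes F G :: "'a::comm_ring_1 fps"
  assumes "F * G = 1" "fps_nth F 0 = 1"
  shows "det (toeplitz_rows n m F (\<lambda>_. 0)) = 1"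
proof -
  have "fps_nth (F * G) 0 = 1" using assms(1) by simp
  then have "fps_nth G 0 = 1" using assms(2) by simp
  then show ?thesis
    using jacobi_trudi_minors[OF zero_partition _ assms(1), of m n] assms(2)
    by (simp add: det_fps_coeff_unitriangular)
qed

text \<open>
  The last box of the last nonzero row is a corner, so the diagram without it belongs to a partition, and
  the conjugate loses exactly the corresponding box.
\<close>

lemma remove_last_box:
  assumes lam: "lam \<in> partitions n" and ne: "lam \<noteq> (\<lambda>_. 0)"
  obtains l where "l \<in> {1..n}" "lam l > 0" "lam(l := lam l - 1) \<in> partitions n"
    "conjugate lam (lam l) = l"
    "conjugate (lam(l := lam l - 1)) = (conjugate lam)(lam l := l - 1)"
proof
  let ?l = "conjugate lam 1"
  let ?mu = "lam(?l := lam ?l - 1)"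
  obtain i where i: "lam i > 0" using ne by auto
  then have "i \<ge> 1" using partitionsD(2)[OF lam, of i] by (cases i) auto
  then have l1: "?l \<ge> 1"
    using le_conjugate_iff[OF lam, of 1 i] i by simp
  then show l: "?l \<in> {1..n}"
    using conjugate_le[OF lam] by simp
  show pos: "lam ?l > 0"
    using le_conjugate_iff[OF lam, of 1 ?l] l1 by simp
  have beyond: "lam j = 0" if "j > ?l" for j
    using le_conjugate_iff[OF lam, of 1 j] that by simp
  show mu: "?mu \<in> partitions n"
    unfolding partitions_def
  proof (intro CollectI conjI allI impI)
    fix i j :: nat
    assume ij: "1 \<le> i \<and> i \<le> j"
    then have "lam j \<le> lam i" using partitionsD(1)[OF lam] by blast
    then show "?mu j \<le> ?mu i"
      using ij beyond[of j] by (cases "j = ?l"; cases "i = ?l") auto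
  next
    fix i assume "i \<notin> {1..n}"
    then show "?mu i = 0" using l partitionsD(2)[OF lam] by auto
  qed
  show cl: "conjugate lam (lam ?l) = ?l"
  proof (rule antisym)
    show "?l \<le> conjugate lam (lam ?l)"
      using le_conjugate_iff[OF lam, of "lam ?l" ?l] pos l1 by simp
    show "conjugate lam (lam ?l) \<le> ?l"
      using le_conjugate_iff[OF lam, of "lam ?l" "?l + 1"] beyond[of "?l + 1"] pos by simp
  qed
  show "conjugate ?mu = (conjugate lam)(lam ?l := ?l - 1)"
  proof
    fix k
    show "conjugate ?mu k = ((conjugate lam)(lam ?l := ?l - 1)) k"
    proof (cases "k = 0")
      case True
      then show ?thesis using pos by (simp add: conjugate_def)
    next
      case False
      have "i \<le> conjugate ?mu k \<longleftrightarrow> i \<le> ((conjugate lam)(lam ?l := ?l - 1)) k" if "i \<ge> 1" for i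
        using le_conjugate_iff[OF mu, of k i] le_conjugate_iff[OF lam, of k i] that False cl pos
        by (cases "k = lam ?l"; cases "i = ?l") auto
      moreover have "a = b" if "\<And>i. i \<ge> 1 \<Longrightarrow> i \<le> a \<longleftrightarrow> i \<le> b" for a b :: nat
        using that[of a] that[of b] by (cases "a = 0"; cases "b = 0") auto
      ultimately show ?thesis by blast
    qed
  qed
qed

text \<open>
  Removing a corner exchanges two of the listed rows, so the sign changes with every box. Counting the boxes
  by columns gives the exponent in the form that cancels the signs in \<open>det_alternating_signs\<close>.
\<close>

lemma det_toeplitz_rows:
  fixes F G :: "'a::comm_ring_1 fps"
  assumes "F * G = 1" "fps_nth F 0 = 1" and "lam \<in> partitions n" "lam 1 \<le> m"
  shows "det (toeplitz_rows n m F lam) = (- 1) ^ (\<Sum>k = 1..m. conjugate lam k)"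
  using assms(3,4)
proof (induction "\<Sum>i = 1..n. lam i" arbitrary: lam rule: less_induct)
  case (less lam)
  show ?case
  proof (cases "lam = (\<lambda>_. 0)")
    case True
    then show ?thesis using det_toeplitz_rows_empty[OF assms(1,2)] by simp
  next
    case False
    obtain l where l: "l \<in> {1..n}" "lam l > 0" "lam(l := lam l - 1) \<in> partitions n"
        "conjugate lam (lam l) = l"
        "conjugate (lam(l := lam l - 1)) = (conjugate lam)(lam l := l - 1)"
      using remove_last_box[OF less.prems(1) False] .
    let ?mu = "lam(l := lam l - 1)"
    have lm: "lam l \<in> {1..m}"
      using partitionsD(1)[OF less.prems(1), of 1 l] l less.prems(2) by auto
    have first: "?mu 1 \<le> m" using less.prems(2) by auto
    have smaller: "(\<Sum>i = 1..n. ?mu i) < (\<Sum>i = 1..n. lam i)"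
      by (rule sum_strict_mono_ex1) (use l(1,2) in auto)
    have IH: "det (toeplitz_rows n m F ?mu) = (- 1) ^ (\<Sum>k = 1..m. conjugate ?mu k)"
      by (rule less.hyps[OF smaller l(3) first])
    have "(\<Sum>k = 1..m. conjugate lam k) = l + (\<Sum>k\<in>{1..m} - {lam l}. conjugate lam k)"
      using lm l(4) by (subst sum.remove[of _ "lam l"]) auto
    moreover have "(\<Sum>k = 1..m. conjugate ?mu k) = l - 1 + (\<Sum>k\<in>{1..m} - {lam l}. conjugate lam k)"
      unfolding l(5) using lm by (subst sum.remove[of _ "lam l"]) auto
    ultimately have size: "(\<Sum>k = 1..m. conjugate lam k) = Suc (\<Sum>k = 1..m. conjugate ?mu k)"
      using l(1) by simp
    \<comment> \<open>row \<open>l\<close> and column \<open>lam l\<close> of the removed box have the list indices \<open>l - 1\<close> and \<open>n + lam l - 1\<close>\<close>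
    have p1: "partition_positions n lam (l - 1) = partition_positions n ?mu (n + lam l - 1)"
      using l lm by (auto simp: partition_positions_def)
    have p2: "partition_positions n lam (n + lam l - 1) = partition_positions n ?mu (l - 1)"
      using l lm by (auto simp: partition_positions_def)
    have p3: "partition_positions n lam x = partition_positions n ?mu x"
      if "x \<noteq> l - 1" "x \<noteq> n + lam l - 1" for x
      using l lm that by (auto simp: partition_positions_def)
    have idx: "l - 1 < n + m" "n + lam l - 1 < n + m" "l - 1 \<noteq> n + lam l - 1"
      using l lm by auto
    have "toeplitz_rows n m F lam = swaprows (l - 1) (n + lam l - 1) (toeplitz_rows n m F ?mu)"
      using idx p1 p2 p3 by (intro eq_matI) (auto simp: toeplitz_rows_def simp del: fun_upd_apply)
    moreover have "toeplitz_rows n m F ?mu \<in> carrier_mat (n + m) (n + m)"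
      by (simp add: toeplitz_rows_def)
    ultimately have "det (toeplitz_rows n m F lam) = - det (toeplitz_rows n m F ?mu)"
      by (simp only: det_swaprows[OF idx])
    then show ?thesis
      unfolding IH size by simp
  qed
qed

text \<open>
  Modulo \<open>2\<close> the index \<open>c\<^sub>i - i + j\<close> is a sum of a function of the row and a function of the column, so the
  signs can be pulled out of the rows and columns.
\<close>

lemma det_alternating_signs:
  fixes G :: "'a::comm_ring_1 fps"
  shows "det (mat m m (\<lambda>(i, j). fps_coeff G (int (c i) - int i + int j))) =
    (- 1) ^ (\<Sum>i<m. c i) *
    det (mat m m (\<lambda>(i, j). fps_coeff (Abs_fps (\<lambda>k. (- 1) ^ k * fps_nth G k)) (int (c i) - int i + int j)))"
    (is "det ?A = _ * det ?B")
proof -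
  let ?s = "(- 1) ^ (\<Sum>i<m. c i) :: 'a"
  have entry: "fps_coeff G (int (c i) - int i + int j) = (- 1) ^ (c i + i + j) *
      fps_coeff (Abs_fps (\<lambda>k. (- 1) ^ k * fps_nth G k)) (int (c i) - int i + int j)" for i j
  proof (cases "i \<le> c i + j")
    case True
    then have "nat (int (c i) - int i + int j) = c i + j - i" by simp
    moreover have "even (c i + i + j + (c i + j - i))"
      using True by presburger
    then have "(- 1) ^ (c i + i + j) * (- 1) ^ (c i + j - i) = (1 :: 'a)"
      by (simp only: power_add[symmetric] neg_one_even_power)
    ultimately show ?thesis
      using True by (simp add: fps_coeff_def mult.assoc[symmetric])
  qed (simp add: fps_coeff_def)
  have "signof p * (\<Prod>i = 0..<m. ?A $$ (i, p i)) = ?s * (signof p * (\<Prod>i = 0..<m. ?B $$ (i, p i)))"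
    if p: "p permutes {0..<m}" for p
  proof -
    have "(\<Prod>i = 0..<m. ?A $$ (i, p i)) = (\<Prod>i = 0..<m. (- 1) ^ (c i + i + p i) * ?B $$ (i, p i))"
    proof (rule prod.cong)
      fix i assume "i \<in> {0..<m}"
      then have "i < m" "p i < m" using permutes_in_image[OF p, of i] by auto
      then show "?A $$ (i, p i) = (- 1) ^ (c i + i + p i) * ?B $$ (i, p i)"
        using entry[of i "p i"] by simp
    qed simp
    also have "\<dots> = (- 1) ^ (\<Sum>i = 0..<m. c i + i + p i) * (\<Prod>i = 0..<m. ?B $$ (i, p i))"
      by (simp add: prod.distrib power_sum)
    also have "(\<Sum>i = 0..<m. p i) = (\<Sum>i = 0..<m. i)"
      using sum.permute[OF p, of "\<lambda>i. i"] by (simp add: comp_def)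
    then have "(\<Sum>i = 0..<m. c i + i + p i) = (\<Sum>i<m. c i) + 2 * (\<Sum>i = 0..<m. i)"
      by (simp only: sum.distrib atLeast0LessThan)
    then have "(- 1) ^ (\<Sum>i = 0..<m. c i + i + p i) = ?s"
      by (simp only: power_add power_mult) simp
    finally show ?thesis by (simp only: mult.left_commute)
  qed
  then show ?thesis
    by (simp add: det_def'[of _ m] sum_distrib_left)
qed

text \<open>
  The sign of the row arrangement and the alternating signs of the inverse series are both \<open>-1\<close> to the
  number of boxes and cancel.
\<close>

theorem jacobi_trudi_dual:
  fixes F G :: "'a::comm_ring_1 fps"
  assumes FG: "F * G = 1" "fps_nth F 0 = 1" and lam: "lam \<in> partitions n" "lam 1 \<le> m"
  shows "det (mat n n (\<lambda>(i, j). fps_coeff F (int (lam (i + 1)) - int i + int j))) =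
    det (mat m m (\<lambda>(i, j). fps_coeff (Abs_fps (\<lambda>k. (- 1) ^ k * fps_nth G k))
      (int (conjugate lam (i + 1)) - int i + int j)))"
proof -
  have "(\<Sum>i<m. conjugate lam (i + 1)) = (\<Sum>k = 1..m. conjugate lam k)"
    by (rule sum.reindex_bij_witness[of _ "\<lambda>k. k - 1" "\<lambda>i. i + 1"]) auto
  then show ?thesis
    unfolding jacobi_trudi_minors[OF lam FG(1)] det_toeplitz_rows[OF FG lam]
    using det_alternating_signs[of m G "\<lambda>i. conjugate lam (i + 1)"]
    by (simp add: mult.assoc[symmetric] power_add[symmetric])
qed

section \<open>Symmetric elements\<close>

text \<open>
  For polynomials this is invariance under exchanging \<open>y\<^sub>r\<close> and \<open>y\<^bsub>r+1\<^esub>\<close>. Stating it as a commutation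
  relation inside the algebra replaces the action of the symmetric group and the divided difference operators.
\<close>

definition psi_invariant :: "nat \<Rightarrow> ('k::field, 'n::finite) ypoly \<Rightarrow> bool"
  where "psi_invariant r f \<longleftrightarrow> nh_psi r * ypoly_val f = ypoly_val f * nh_psi r"

lemma psi_invariant_basic [simp]:
  "psi_invariant r 0" "psi_invariant r 1"
  by (simp_all add: psi_invariant_def)

lemma psi_invariant_diff: "psi_invariant r a \<Longrightarrow> psi_invariant r b \<Longrightarrow> psi_invariant r (a - b)"
  by (simp add: psi_invariant_def algebra_simps)

lemma psi_invariant_add: "psi_invariant r a \<Longrightarrow> psi_invariant r b \<Longrightarrow> psi_invariant r (a + b)"
  by (simp add: psi_invariant_def algebra_simps)

lemma psi_invariant_minus: "psi_invariant r a \<Longrightarrow> psi_invariant r (- a)"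
  by (simp add: psi_invariant_def)

lemma psi_invariant_mult: "psi_invariant r a \<Longrightarrow> psi_invariant r b \<Longrightarrow> psi_invariant r (a * b)"
  unfolding psi_invariant_def ypoly_val_simps
  by (simp only: mult.assoc[symmetric]) (simp only: mult.assoc)

lemma psi_invariant_sum: "(\<And>x. x \<in> A \<Longrightarrow> psi_invariant r (f x)) \<Longrightarrow> psi_invariant r (sum f A)"
  by (induction A rule: infinite_finite_induct) (auto intro: psi_invariant_add)

lemma psi_invariant_prod: "(\<And>x. x \<in> A \<Longrightarrow> psi_invariant r (f x)) \<Longrightarrow> psi_invariant r (prod f A)"
  by (induction A rule: infinite_finite_induct) (auto intro: psi_invariant_mult)

lemma psi_invariant_power: "psi_invariant r f \<Longrightarrow> psi_invariant r (f ^ k)"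
  by (induction k) (auto intro: psi_invariant_mult)

lemma psi_invariant_yvar:
  assumes "r \<in> {1..<CARD('n)}" "k \<in> {1..CARD('n)}" "k \<noteq> r" "k \<noteq> r + 1"
  shows "psi_invariant r (yvar k :: ('k::field, 'n::finite) ypoly)"
  using assms nh_psi_y_comm by (simp add: psi_invariant_def)

lemma psi_invariant_elementary:
  assumes r: "r \<in> {1..<CARD('n)}"
  shows "psi_invariant r (yvar r + yvar (r + 1) :: ('k::field, 'n::finite) ypoly)"
    and "psi_invariant r (yvar r * yvar (r + 1) :: ('k, 'n) ypoly)"
proof -
  let ?s = "nh_psi r :: ('k, 'n) nilhecke" and ?x = "nh_y r :: ('k, 'n) nilhecke"
    and ?z = "nh_y (r + 1) :: ('k, 'n) nilhecke"
  have mem: "r \<in> {1..CARD('n)}" "r + 1 \<in> {1..CARD('n)}" using r by auto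
  have xz: "?x * ?z = ?z * ?x" by (rule nh_y_comm[OF mem])
  note rel = nh_psi_y[OF r, where 'k = 'k] nh_psi_y_Suc[OF r, where 'k = 'k]
  show "psi_invariant r (yvar r + yvar (r + 1) :: ('k, 'n) ypoly)"
    unfolding psi_invariant_def ypoly_val_simps ypoly_val_yvar[OF mem(1)] ypoly_val_yvar[OF mem(2)]
      distrib_left distrib_right rel by simp
  have "?s * (?x * ?z) = (?z * ?s - 1) * ?z"
    by (simp only: mult.assoc[symmetric] rel)
  also have "\<dots> = ?z * (?x * ?s + 1) - ?z"
    by (simp only: left_diff_distrib mult.assoc rel mult_1_left)
  also have "\<dots> = ?x * ?z * ?s"
    by (simp only: distrib_left mult.assoc[symmetric] xz mult_1_right add_diff_cancel_right')
  finally show "psi_invariant r (yvar r * yvar (r + 1) :: ('k, 'n) ypoly)"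
    unfolding psi_invariant_def ypoly_val_simps ypoly_val_yvar[OF mem(1)] ypoly_val_yvar[OF mem(2)] .
qed

text \<open>
  Newton's recursion reduces power sums in two variables to \<open>x + z\<close> and \<open>x z\<close>.
\<close>

lemma psi_invariant_power_sum:
  assumes "r \<in> {1..<CARD('n)}"
  shows "psi_invariant r (yvar r ^ d + yvar (r + 1) ^ d :: ('k::field, 'n::finite) ypoly)"
proof (induction d rule: less_induct)
  case (less d)
  let ?x = "yvar r :: ('k, 'n) ypoly" and ?z = "yvar (r + 1) :: ('k, 'n) ypoly"
  note inv = psi_invariant_elementary[OF assms, where 'k = 'k]
  consider "d = 0" | "d = 1" | e where "d = e + 2"
    by (metis One_nat_def Suc_1 add_2_eq_Suc' not0_implies_Suc)
  then show ?case
  proof cases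
    case 1
    then show ?thesis unfolding 1 power_0 by (intro psi_invariant_add psi_invariant_basic)
  next
    case 2
    then show ?thesis using inv(1) by simp
  next
    case 3
    have "?x ^ d + ?z ^ d = (?x + ?z) * (?x ^ (e + 1) + ?z ^ (e + 1)) - ?x * ?z * (?x ^ e + ?z ^ e)"
      by (simp add: 3 algebra_simps)
    moreover have "psi_invariant r (?x ^ e + ?z ^ e)" "psi_invariant r (?x ^ (e + 1) + ?z ^ (e + 1))"
      by (rule less.IH, simp add: 3)+
    ultimately show ?thesis
      by (simp only: psi_invariant_diff[OF psi_invariant_mult[OF inv(1)] psi_invariant_mult[OF inv(2)]])
  qed
qed

lemma psi_invariant_monomial_sum:
  assumes "r \<in> {1..<CARD('n)}"
  shows "psi_invariant r
    (yvar r ^ a * yvar (r + 1) ^ b + yvar r ^ b * yvar (r + 1) ^ a :: ('k::field, 'n::finite) ypoly)"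
proof -
  have le: "psi_invariant r
      (yvar r ^ a * yvar (r + 1) ^ b + yvar r ^ b * yvar (r + 1) ^ a :: ('k, 'n) ypoly)"
    if "a \<le> b" for a b
  proof -
    let ?x = "yvar r :: ('k, 'n) ypoly" and ?z = "yvar (r + 1) :: ('k, 'n) ypoly"
    obtain d where "b = a + d" using \<open>a \<le> b\<close> le_Suc_ex by blast
    then have "?x ^ a * ?z ^ b + ?x ^ b * ?z ^ a = (?x * ?z) ^ a * (?x ^ d + ?z ^ d)"
      by (simp add: algebra_simps power_add power_mult_distrib)
    then show ?thesis
      by (simp only: psi_invariant_mult[OF psi_invariant_power[OF psi_invariant_elementary(2)[OF assms]]
            psi_invariant_power_sum[OF assms]])
  qed
  show ?thesis
    using le[of a b] le[of b a] by (cases "a \<le> b") (simp_all add: add.commute)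
qed

section \<open>An alternating functional on monomials\<close>

definition sandwich :: "('k::field, 'n::finite) ypoly \<Rightarrow> ('k, 'n) nilhecke"
  where "sandwich f = psi_longest * ypoly_val f * psi_longest"

lemma sandwich_add: "sandwich (f + g) = sandwich f + sandwich g"
  by (simp add: sandwich_def algebra_simps)

lemma sandwich_zero [simp]: "sandwich 0 = 0"
  by (simp add: sandwich_def)

lemma sandwich_sum: "sandwich (sum f A) = (\<Sum>x\<in>A. sandwich (f x))"
  by (induction A rule: infinite_finite_induct) (simp_all add: sandwich_add)

text \<open>
  One factor \<open>\<psi>\<^sub>r\<close> is split off the left copy of \<open>psi_longest\<close>, moved through \<open>f\<close>, and annihilates the right copy.
\<close>

lemma sandwich_psi_invariant:
  assumes r: "r \<in> {1..<CARD('n)}" and f: "psi_invariant r (f :: ('k::field, 'n::finite) ypoly)"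
  shows "sandwich f = 0"
proof -
  obtain a b :: "('k, 'n) nilhecke" where b: "psi_longest = b * nh_psi r"
    using psi_longest_factors[OF r] by blast
  have "sandwich f = b * (nh_psi r * ypoly_val f) * psi_longest"
    by (simp add: sandwich_def b mult.assoc)
  also have "\<dots> = b * ypoly_val f * (nh_psi r * psi_longest)"
    using f by (simp add: psi_invariant_def mult.assoc)
  finally show ?thesis by (simp add: psi_mult_longest[OF r])
qed

definition symmetric :: "('k::field, 'n::finite) ypoly \<Rightarrow> bool"
  where "symmetric f \<longleftrightarrow> (\<forall>r\<in>{1..<CARD('n)}. psi_invariant r f)"

lemma symmetric_commute_psi_longest:
  assumes "symmetric (f :: ('k::field, 'n::finite) ypoly)"
  shows "ypoly_val f * psi_longest = psi_longest * ypoly_val f"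
proof -
  have "ypoly_val f * prod_list (map nh_psi ws) = prod_list (map nh_psi ws) * ypoly_val f"
    if "set ws \<subseteq> {1..<CARD('n)}" for ws
    using that
  proof (induction ws)
    case (Cons r ws)
    then have "ypoly_val f * nh_psi r = nh_psi r * ypoly_val f"
      using assms by (simp add: symmetric_def psi_invariant_def)
    then have "ypoly_val f * (nh_psi r * prod_list (map nh_psi ws)) =
        nh_psi r * (ypoly_val f * prod_list (map nh_psi ws))"
      by (simp only: mult.assoc[symmetric])
    also have "\<dots> = nh_psi r * (prod_list (map nh_psi ws) * ypoly_val f)"
      using Cons by simp
    finally show ?case by (simp only: list.map prod_list.Cons mult.assoc)
  qed simp
  then show ?thesis
    unfolding psi_longest_staircase using set_staircase_word by blast
qed

lemma sandwich_symmetric_mult: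
  "symmetric c \<Longrightarrow> sandwich (c * f) = ypoly_val c * sandwich f"
  unfolding sandwich_def ypoly_val_simps
  by (simp only: mult.assoc[symmetric] symmetric_commute_psi_longest)

definition ymonom :: "(nat \<Rightarrow> nat) \<Rightarrow> ('k::field, 'n::finite) ypoly"
  where "ymonom a = (\<Prod>i = 1..CARD('n). yvar i ^ a i)"

lemma ymonom_split:
  assumes r: "r \<in> {1..<CARD('n)}"
  shows "(ymonom a :: ('k::field, 'n::finite) ypoly) =
    (\<Prod>i\<in>{1..CARD('n)} - {r, r + 1}. yvar i ^ a i) * (yvar r ^ a r * yvar (r + 1) ^ a (r + 1))"
proof -
  have "{1..CARD('n)} = insert r (insert (r + 1) ({1..CARD('n)} - {r, r + 1}))"
    using r by auto
  then have "(ymonom a :: ('k, 'n) ypoly) =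
      prod (\<lambda>i. yvar i ^ a i) (insert r (insert (r + 1) ({1..CARD('n)} - {r, r + 1})))"
    unfolding ymonom_def by simp
  also have "\<dots> = yvar r ^ a r * (yvar (r + 1) ^ a (r + 1) * (\<Prod>i\<in>{1..CARD('n)} - {r, r + 1}. yvar i ^ a i))"
    by (subst prod.insert; simp)+
  finally show ?thesis by (simp add: algebra_simps)
qed

lemma psi_invariant_rest:
  assumes r: "r \<in> {1..<CARD('n)}"
  shows "psi_invariant r (\<Prod>i\<in>{1..CARD('n)} - {r, r + 1}. yvar i ^ a i :: ('k::field, 'n::finite) ypoly)"
  by (intro psi_invariant_prod psi_invariant_power psi_invariant_yvar r) auto

text \<open>
  The sum of the two monomials is invariant under exchanging \<open>y\<^sub>r\<close> and \<open>y\<^bsub>r+1\<^esub>\<close>, hence killed.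
\<close>

lemma sandwich_swap:
  assumes r: "r \<in> {1..<CARD('n)}"
  shows "sandwich (ymonom (a \<circ> transpose r (r + 1))) = - sandwich (ymonom a :: ('k::field, 'n::finite) ypoly)"
proof -
  let ?R = "\<Prod>i\<in>{1..CARD('n)} - {r, r + 1}. yvar i ^ a i :: ('k, 'n) ypoly"
  have R: "(\<Prod>i\<in>{1..CARD('n)} - {r, r + 1}. yvar i ^ (a \<circ> transpose r (r + 1)) i) = ?R"
    by (rule prod.cong) (auto simp: transpose_def)
  have "sandwich (?R * (yvar r ^ a r * yvar (r + 1) ^ a (r + 1) + yvar r ^ a (r + 1) * yvar (r + 1) ^ a r)) = 0"
    by (rule sandwich_psi_invariant[OF r psi_invariant_mult[OF psi_invariant_rest[OF r]
            psi_invariant_monomial_sum[OF r]]])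
  then have "sandwich (ymonom a + ymonom (a \<circ> transpose r (r + 1)) :: ('k, 'n) ypoly) = 0"
    unfolding ymonom_split[OF r] R by (simp add: distrib_left)
  then show ?thesis
    by (simp add: sandwich_add eq_neg_iff_add_eq_0 add.commute)
qed

text \<open>
  This does not follow from \<open>sandwich_swap\<close>, as the characteristic of the field may be \<open>2\<close>.
\<close>

lemma sandwich_adjacent_equal:
  assumes r: "r \<in> {1..<CARD('n)}" and "a r = a (r + 1)"
  shows "sandwich (ymonom a :: ('k::field, 'n::finite) ypoly) = 0"
  unfolding ymonom_split[OF r] assms(2) power_mult_distrib[symmetric]
  by (rule sandwich_psi_invariant[OF r psi_invariant_mult[OF psi_invariant_rest[OF r]
          psi_invariant_power[OF psi_invariant_elementary(2)[OF r]]]])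

lemma sandwich_equal:
  assumes "i \<in> {1..CARD('n)}" "j \<in> {1..CARD('n)}" "i < j" "a i = a j"
  shows "sandwich (ymonom a :: ('k::field, 'n::finite) ypoly) = 0"
  using assms
proof (induction j arbitrary: a)
  case (Suc j)
  show ?case
  proof (cases "i = j")
    case True
    then show ?thesis using Suc.prems by (intro sandwich_adjacent_equal[of i]) auto
  next
    case False
    have "sandwich (ymonom (a \<circ> transpose j (j + 1)) :: ('k, 'n) ypoly) = 0"
      by (rule Suc.IH) (use Suc.prems False in \<open>auto simp: transpose_def\<close>)
    then show ?thesis
      using Suc.prems False by (subst (asm) sandwich_swap) auto
  qed
qed simp

lemma evenperm_word_perm: "set ws \<subseteq> {1..<n} \<Longrightarrow> evenperm (word_perm ws) \<longleftrightarrow> even (length ws)"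
proof (induction ws)
  case (Cons i ws)
  have "permutation (transpose i (i + 1))" by (rule permutation_swap_id)
  moreover have "permutation (word_perm ws)"
    using word_perm_permutes[of ws n] Cons.prems by (auto simp: permutation_permutes)
  ultimately show ?case
    unfolding word_perm_Cons using Cons by (subst evenperm_comp) (auto simp: evenperm_swap)
qed simp

lemma sandwich_word:
  "set ws \<subseteq> {1..<CARD('n)} \<Longrightarrow> sandwich (ymonom (a \<circ> word_perm ws)) =
    (if even (length ws) then 1 else - 1) * sandwich (ymonom a :: ('k::field, 'n::finite) ypoly)"
proof (induction ws arbitrary: a)
  case (Cons r ws)
  have "sandwich (ymonom ((a \<circ> transpose r (r + 1)) \<circ> word_perm ws) :: ('k, 'n) ypoly) =
      (if even (length ws) then 1 else - 1) * sandwich (ymonom (a \<circ> transpose r (r + 1)))"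
    by (rule Cons.IH) (use Cons.prems in simp)
  also have "sandwich (ymonom (a \<circ> transpose r (r + 1)) :: ('k, 'n) ypoly) = - sandwich (ymonom a)"
    by (rule sandwich_swap) (use Cons.prems in simp)
  finally show ?case
    unfolding word_perm_Cons by (simp add: comp_assoc)
qed simp

lemma sandwich_permute:
  assumes "\<sigma> permutes {1..CARD('n)}"
  shows "sandwich (ymonom (a \<circ> \<sigma>)) =
    (if evenperm \<sigma> then 1 else - 1) * sandwich (ymonom a :: ('k::field, 'n::finite) ypoly)"
proof -
  obtain ws where "set ws \<subseteq> {1..<CARD('n)}" "word_perm ws = \<sigma>"
    using ex_word_of_inversion_length[OF assms] .
  then show ?thesis
    using sandwich_word[of ws a, where 'k = 'k and 'n = 'n] evenperm_word_perm[of ws "CARD('n)"] by auto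
qed

lemma sum_injective_eq_sum_permutes:
  fixes f :: "('b \<Rightarrow> 'b) \<Rightarrow> 'c::comm_monoid_add"
  assumes S: "finite S" and f: "\<And>\<sigma>. \<sigma> permutes S \<Longrightarrow> f (restrict \<sigma> S) = f \<sigma>"
  shows "(\<Sum>\<phi> | \<phi> \<in> PiE S (\<lambda>_. S) \<and> inj_on \<phi> S. f \<phi>) = (\<Sum>\<sigma> | \<sigma> permutes S. f \<sigma>)"
proof (rule sum.reindex_bij_witness[of _ "\<lambda>\<sigma>. restrict \<sigma> S" "\<lambda>\<phi> x. if x \<in> S then \<phi> x else x"])
  fix \<phi> assume "\<phi> \<in> {\<phi>. \<phi> \<in> PiE S (\<lambda>_. S) \<and> inj_on \<phi> S}"
  then have \<phi>: "\<phi> \<in> PiE S (\<lambda>_. S)" "inj_on \<phi> S" by simp_all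
  show eq: "restrict (\<lambda>x. if x \<in> S then \<phi> x else x) S = \<phi>"
    using \<phi>(1) by (auto simp: fun_eq_iff PiE_def extensional_def)
  have "bij_betw \<phi> S S"
    using \<phi> S by (intro bij_betw_imageI endo_inj_surj) auto
  then have "bij_betw (\<lambda>x. if x \<in> S then \<phi> x else x) S S"
    by (rule bij_betw_cong[THEN iffD1, rotated]) simp
  then have "(\<lambda>x. if x \<in> S then \<phi> x else x) permutes S"
    by (rule bij_imp_permutes) simp
  then show "(\<lambda>x. if x \<in> S then \<phi> x else x) \<in> {\<sigma>. \<sigma> permutes S}"
    and "f (\<lambda>x. if x \<in> S then \<phi> x else x) = f \<phi>"
    using f eq by fastforce+
next
  fix \<sigma> assume "\<sigma> \<in> {\<sigma>. \<sigma> permutes S}"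
  then have \<sigma>: "\<sigma> permutes S" by simp
  show "(\<lambda>x. if x \<in> S then restrict \<sigma> S x else x) = \<sigma>"
    using permutes_not_in[OF \<sigma>] by (auto simp: fun_eq_iff)
  show "restrict \<sigma> S \<in> {\<phi>. \<phi> \<in> PiE S (\<lambda>_. S) \<and> inj_on \<phi> S}"
    using permutes_in_image[OF \<sigma>] permutes_inj_on[OF \<sigma>] by (auto simp: inj_on_def)
qed

lemma symmetric_prod: "(\<And>x. x \<in> A \<Longrightarrow> symmetric (f x)) \<Longrightarrow> symmetric (prod f A)"
  unfolding symmetric_def by (intro ballI psi_invariant_prod) blast

text \<open>
  Multilinear expansion: the product over \<open>i\<close> of the sums becomes a sum over all maps \<open>\<phi>\<close> from indices to
  indices. The maps that are not injective contribute \<open>0\<close>, and the permutations contribute their signs.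
\<close>

lemma sandwich_determinant:
  fixes C :: "nat \<Rightarrow> nat \<Rightarrow> ('k::field, 'n::finite) ypoly"
  assumes sym: "\<And>i j. symmetric (C i j)"
    and expand: "\<And>i. i \<in> {1..CARD('n)} \<Longrightarrow> yvar i ^ a i = (\<Sum>j = 1..CARD('n). C i j * yvar i ^ d j)"
  shows "sandwich (ymonom a) = ypoly_val (leibniz_det CARD('n) C) * sandwich (ymonom d)"
proof -
  let ?S = "{1..CARD('n)}"
  let ?c = "\<lambda>\<phi>. \<Prod>i\<in>?S. C i (\<phi> i)"
  let ?t = "\<lambda>\<phi>. ypoly_val (?c \<phi>) * sandwich (ymonom (d \<circ> \<phi>))"
  have "ymonom a = (\<Prod>i\<in>?S. \<Sum>j\<in>?S. C i j * yvar i ^ d j)"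
    unfolding ymonom_def by (rule prod.cong) (use expand in simp_all)
  also have "\<dots> = (\<Sum>\<phi>\<in>PiE ?S (\<lambda>_. ?S). \<Prod>i\<in>?S. C i (\<phi> i) * yvar i ^ d (\<phi> i))"
    by (rule prod_sum_PiE) simp_all
  also have "\<dots> = (\<Sum>\<phi>\<in>PiE ?S (\<lambda>_. ?S). ?c \<phi> * ymonom (d \<circ> \<phi>))"
    by (simp add: prod.distrib ymonom_def)
  finally have "sandwich (ymonom a) = (\<Sum>\<phi>\<in>PiE ?S (\<lambda>_. ?S). ?t \<phi>)"
    by (simp only: sandwich_sum sandwich_symmetric_mult symmetric_prod sym)
  also have "\<dots> = (\<Sum>\<phi> | \<phi> \<in> PiE ?S (\<lambda>_. ?S) \<and> inj_on \<phi> ?S. ?t \<phi>)"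
  proof (rule sum.mono_neutral_right)
    show "finite (PiE ?S (\<lambda>_. ?S))" by (intro finite_PiE) simp_all
    show "\<forall>\<phi>\<in>PiE ?S (\<lambda>_. ?S) - {\<phi> \<in> PiE ?S (\<lambda>_. ?S). inj_on \<phi> ?S}. ?t \<phi> = 0"
    proof
      fix \<phi> assume "\<phi> \<in> PiE ?S (\<lambda>_. ?S) - {\<phi> \<in> PiE ?S (\<lambda>_. ?S). inj_on \<phi> ?S}"
      then have "\<not> inj_on \<phi> ?S" by simp
      then obtain i j where "i \<in> ?S" "j \<in> ?S" "i < j" "\<phi> i = \<phi> j"
        by (metis linorder_inj_onI' )
      then show "?t \<phi> = 0"
        by (simp add: sandwich_equal[of i j])
    qed
  qed auto
  also have "\<dots> = (\<Sum>\<sigma> | \<sigma> permutes ?S. ?t \<sigma>)"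
  proof (rule sum_injective_eq_sum_permutes)
    fix \<sigma> assume "\<sigma> permutes ?S"
    have "?c (restrict \<sigma> ?S) = ?c \<sigma>" by (rule prod.cong) simp_all
    moreover have "(ymonom (d \<circ> restrict \<sigma> ?S) :: ('k, 'n) ypoly) = ymonom (d \<circ> \<sigma>)"
      unfolding ymonom_def by (rule prod.cong) simp_all
    ultimately show "?t (restrict \<sigma> ?S) = ?t \<sigma>" by (simp only:)
  qed simp
  also have "\<dots> = (\<Sum>\<sigma> | \<sigma> permutes ?S.
      ypoly_val ((if evenperm \<sigma> then 1 else - 1) * ?c \<sigma>) * sandwich (ymonom d))"
    by (rule sum.cong) (simp_all add: sandwich_permute)
  finally show ?thesis
    by (simp only: leibniz_det_prod ypoly_val_sum sum_distrib_right)
qed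

section \<open>Complete and elementary symmetric functions\<close>

text \<open>
  The generating function of \<open>(-1)\<^sup>k e\<^sub>k\<close>, the inverse of the one of \<open>h\<^sub>k\<close>.
\<close>

definition elementary_fps :: "('k::field, 'n::finite) ypoly fps"
  where "elementary_fps = (\<Prod>i = 1..CARD('n). 1 - fps_const (yvar i) * fps_X)"

definition complete_fps :: "('k::field, 'n::finite) ypoly fps"
  where "complete_fps = (\<Prod>i = 1..CARD('n). Abs_fps (\<lambda>k. yvar i ^ k))"

lemma linear_mult_geometric:
  "(1 - fps_const c * fps_X) * Abs_fps (\<lambda>k. c ^ k) = (1 :: 'a::comm_ring_1 fps)"
proof (rule fps_ext)
  fix k
  show "((1 - fps_const c * fps_X) * Abs_fps (\<lambda>k. c ^ k)) $ k = (1 :: 'a fps) $ k"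
    by (cases k) (simp_all add: left_diff_distrib mult.assoc fps_X_mult_nth)
qed

text \<open>
  A product of linear factors has degree at most the number of factors.
\<close>

lemma linear_prod_nth_eq_0:
  fixes c :: "'i \<Rightarrow> 'a::comm_ring_1"
  assumes "finite S" "card S < k"
  shows "(\<Prod>i\<in>S. 1 - fps_const (c i) * fps_X) $ k = 0"
  using assms
proof (induction S arbitrary: k rule: finite_induct)
  case (insert i S)
  then show ?case
    by (simp add: left_diff_distrib mult.assoc fps_X_mult_nth)
qed simp

lemma complete_mult_elementary: "complete_fps * elementary_fps = 1"
  unfolding complete_fps_def elementary_fps_def prod.distrib[symmetric]
  by (subst mult.commute) (simp only: linear_mult_geometric prod.neutral_const)

lemma elementary_fps_0: "elementary_fps $ 0 = 1"
proof -
  have "(\<Prod>i\<in>S. 1 - fps_const (c i) * fps_X) $ 0 = 1" 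
    for S and c :: "nat \<Rightarrow> ('k::field, 'n::finite) ypoly"
    by (induction S rule: infinite_finite_induct) simp_all
  then show ?thesis unfolding elementary_fps_def .
qed

lemma complete_fps_0: "complete_fps $ 0 = 1"
proof -
  have "(complete_fps * elementary_fps) $ 0 = 1"
    unfolding complete_mult_elementary by simp
  then show ?thesis by (simp add: elementary_fps_0)
qed

lemma elementary_fps_nth_eq_0: "CARD('n) < k \<Longrightarrow> (elementary_fps :: ('k::field, 'n::finite) ypoly fps) $ k = 0"
  unfolding elementary_fps_def by (rule linear_prod_nth_eq_0) simp_all

lemma psi_invariant_fps_mult:
  "(\<And>k. psi_invariant r (F $ k)) \<Longrightarrow> (\<And>k. psi_invariant r (G $ k)) \<Longrightarrow> psi_invariant r ((F * G) $ k)"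
  unfolding fps_mult_nth by (intro psi_invariant_sum psi_invariant_mult)

lemma psi_invariant_fps_prod:
  "(\<And>x k. x \<in> A \<Longrightarrow> psi_invariant r (F x $ k)) \<Longrightarrow> psi_invariant r (prod F A $ k)"
proof (induction A arbitrary: k rule: infinite_finite_induct)
  case (insert x A)
  then show ?case by (simp add: psi_invariant_fps_mult)
qed (simp_all add: psi_invariant_basic)

text \<open>
  The factors for \<open>r\<close> and \<open>r + 1\<close> multiply to \<open>1 - (y\<^sub>r + y\<^bsub>r+1\<^esub>) T + y\<^sub>r y\<^bsub>r+1\<^esub> T\<^sup>2\<close>, and \<open>\<psi>\<^sub>r\<close> commutes with
  the coefficients of this factor as with those of all the others.
\<close>

lemma symmetric_elementary_fps:
  "symmetric ((elementary_fps :: ('k::field, 'n::finite) ypoly fps) $ k)"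
  unfolding symmetric_def
proof
  fix r assume r: "r \<in> {1..<CARD('n)}"
  let ?f = "\<lambda>i. 1 - fps_const (yvar i :: ('k, 'n) ypoly) * fps_X"
  let ?rest = "{1..CARD('n)} - {r, r + 1}"
  have split: "{1..CARD('n)} = insert r (insert (r + 1) ?rest)"
    using r by auto
  have "elementary_fps = prod ?f (insert r (insert (r + 1) ?rest))"
    unfolding elementary_fps_def using split by simp
  also have "\<dots> = ?f r * (?f (r + 1) * prod ?f ?rest)"
    by (subst prod.insert; simp)+
  also have "\<dots> = (?f r * ?f (r + 1)) * prod ?f ?rest"
    by (simp only: mult.assoc)
  also have "?f r * ?f (r + 1) =
      1 - fps_const (yvar r + yvar (r + 1)) * fps_X + fps_const (yvar r * yvar (r + 1)) * fps_X ^ 2"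
    by (simp add: algebra_simps power2_eq_square fps_const_add[symmetric] fps_const_mult[symmetric]
        del: fps_const_add fps_const_mult)
  finally have E: "(elementary_fps :: ('k, 'n) ypoly fps) = (1 - fps_const (yvar r + yvar (r + 1)) * fps_X
      + fps_const (yvar r * yvar (r + 1)) * fps_X ^ 2) * prod ?f ?rest" .
  have one: "psi_invariant r ((1 :: ('k, 'n) ypoly fps) $ k)" for k
    by (cases k) simp_all
  have X: "psi_invariant r (((fps_X :: ('k, 'n) ypoly fps) ^ m) $ k)" for k m
    by (simp add: fps_X_power_nth)
  have const: "psi_invariant r (fps_const c $ k)" if "psi_invariant r c" for c :: "('k, 'n) ypoly" and k
    using that by (cases k) simp_all
  have quad: "psi_invariant r ((1 - fps_const (yvar r + yvar (r + 1)) * fps_X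
      + fps_const (yvar r * yvar (r + 1)) * fps_X ^ 2 :: ('k, 'n) ypoly fps) $ k)" for k
    using psi_invariant_fps_mult[OF const[OF psi_invariant_elementary(1)[OF r]] X[where m = 1], of k]
      psi_invariant_fps_mult[OF const[OF psi_invariant_elementary(2)[OF r]] X[where m = 2], of k] one[of k]
    unfolding fps_add_nth fps_sub_nth power_one_right
    by (intro psi_invariant_add psi_invariant_diff)
  have linear: "psi_invariant r (?f i $ k)" if "i \<in> ?rest" for i k
  proof -
    have "psi_invariant r (yvar i :: ('k, 'n) ypoly)"
      by (rule psi_invariant_yvar) (use r that in auto)
    from psi_invariant_diff[OF one psi_invariant_fps_mult[OF const[OF this] X[where m = 1]]]
    show ?thesis unfolding fps_sub_nth power_one_right .
  qed
  show "psi_invariant r ((elementary_fps :: ('k, 'n) ypoly fps) $ k)"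
    unfolding E by (rule psi_invariant_fps_mult[OF quad psi_invariant_fps_prod[OF linear]])
qed

text \<open>
  The recursion \<open>h\<^sub>k = - \<Sum>i<k. h\<^sub>i (-1)\<^bsup>k-i\<^esup> e\<^bsub>k-i\<^esub>\<close> for \<open>k > 0\<close> transfers symmetry from the \<open>e\<^sub>i\<close> to the \<open>h\<^sub>k\<close>.
\<close>

lemma symmetric_complete_fps:
  "symmetric ((complete_fps :: ('k::field, 'n::finite) ypoly fps) $ k)"
  unfolding symmetric_def
proof
  fix r assume r: "r \<in> {1..<CARD('n)}"
  let ?H = "complete_fps :: ('k, 'n) ypoly fps" and ?E = "elementary_fps :: ('k, 'n) ypoly fps"
  show "psi_invariant r (?H $ k)"
  proof (induction k rule: less_induct)
    case (less k)
    \<comment> \<open>the last summand of the convolution is split off, using that the constant coefficient of \<open>E\<close> is \<open>1\<close>\<close>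
    have "(\<Sum>i<k. ?H $ i * ?E $ (k - i)) + ?H $ k = (?H * ?E) $ k"
      by (simp add: fps_mult_nth elementary_fps_0 lessThan_Suc_atMost[symmetric] atLeast0AtMost)
    then have eq: "?H $ k = (1 :: ('k, 'n) ypoly fps) $ k - (\<Sum>i<k. ?H $ i * ?E $ (k - i))"
      by (simp add: complete_mult_elementary algebra_simps)
    have "psi_invariant r (?E $ i)" for i
      using symmetric_elementary_fps[of i, where 'k = 'k and 'n = 'n] r by (simp add: symmetric_def)
    then have "psi_invariant r (\<Sum>i<k. ?H $ i * ?E $ (k - i))"
      using less by (intro psi_invariant_sum psi_invariant_mult) auto
    moreover have "psi_invariant r ((1 :: ('k, 'n) ypoly fps) $ k)"
      by (cases k) simp_all
    ultimately show ?case
      unfolding eq by (intro psi_invariant_diff)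
  qed
qed

text \<open>
  With \<open>E = \<Prod>j. (1 - y\<^sub>j T)\<close> and \<open>H = 1 / E\<close> we have \<open>1 / (1 - y\<^sub>i T) = H Q\<close>, where \<open>Q = E / (1 - y\<^sub>i T)\<close> is
  the product over the indices other than \<open>i\<close>, hence of degree less than \<open>n\<close>. Its coefficients are
  polynomials in \<open>y\<^sub>i\<close> whose coefficients are those of \<open>E\<close>; comparing coefficients of \<open>T\<^sup>a\<close> gives the
  expansion, whose coefficient matrix is a product of an \<open>h\<close> part and a unitriangular \<open>e\<close> part.
\<close>

lemma yvar_power_expansion:
  fixes a :: nat
  assumes i: "i \<in> {1..CARD('n)}"
  shows "(yvar i :: ('k::field, 'n::finite) ypoly) ^ a =
    (\<Sum>j = 1..CARD('n). (\<Sum>l = 1..CARD('n). fps_coeff complete_fps (int a - int CARD('n) + int l) *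
        fps_coeff elementary_fps (int j - int l)) * yvar i ^ (CARD('n) - j))"
proof -
  let ?n = "CARD('n)" and ?y = "yvar i :: ('k, 'n) ypoly"
  let ?H = "complete_fps :: ('k, 'n) ypoly fps" and ?E = "elementary_fps :: ('k, 'n) ypoly fps"
  let ?Q = "?E * Abs_fps (\<lambda>k. ?y ^ k)"
  have "?E = (1 - fps_const ?y * fps_X) * (\<Prod>j\<in>{1..?n} - {i}. 1 - fps_const (yvar j) * fps_X)"
    unfolding elementary_fps_def by (rule prod.remove) (use i in simp_all)
  then have "?Q = ((1 - fps_const ?y * fps_X) * Abs_fps (\<lambda>k. ?y ^ k)) *
      (\<Prod>j\<in>{1..?n} - {i}. 1 - fps_const (yvar j) * fps_X)"
    by (simp only: mult.assoc mult.commute mult.left_commute)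
  then have Q: "?Q = (\<Prod>j\<in>{1..?n} - {i}. 1 - fps_const (yvar j) * fps_X)"
    by (simp only: linear_mult_geometric mult_1_left)
  \<comment> \<open>\<open>Q\<close> has only \<open>n - 1\<close> factors\<close>
  have Q0: "?Q $ m = 0" if "?n \<le> m" for m
    unfolding Q by (rule linear_prod_nth_eq_0) (use i that in auto)
  have Ql: "?Q $ (?n - l) = (\<Sum>j = 1..?n. fps_coeff ?E (int j - int l) * ?y ^ (?n - j))"
    if l: "l \<in> {1..?n}" for l
  proof -
    have "?Q $ (?n - l) = (\<Sum>k = 0..?n - l. ?E $ k * ?y ^ (?n - l - k))"
      by (simp add: fps_mult_nth)
    also have "\<dots> = (\<Sum>j = l..?n. fps_coeff ?E (int j - int l) * ?y ^ (?n - j))"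
      by (rule sum.reindex_bij_witness[of _ "\<lambda>j. j - l" "\<lambda>k. k + l"])
        (use l in \<open>auto simp: fps_coeff_def nat_diff_distrib' add.commute\<close>)
    also have "\<dots> = (\<Sum>j = 1..?n. fps_coeff ?E (int j - int l) * ?y ^ (?n - j))"
      by (rule sum.mono_neutral_left) (use l in auto)
    finally show ?thesis .
  qed
  have "?H * ?Q = (?H * ?E) * Abs_fps (\<lambda>k. ?y ^ k)"
    by (simp only: mult.assoc)
  then have "?H * ?Q = Abs_fps (\<lambda>k. ?y ^ k)"
    by (simp only: complete_mult_elementary mult_1_left)
  then have "?y ^ a = (?Q * ?H) $ a"
    by (simp add: mult.commute)
  also have "\<dots> = (\<Sum>m = 0..a. fps_coeff ?H (int a - int m) * ?Q $ m)"
    unfolding fps_mult_nth[of ?Q] by (rule sum.cong) (auto simp: fps_coeff_def nat_diff_distrib' mult.commute)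
  also have "\<dots> = (\<Sum>m\<in>{0..a} \<union> {..<?n}. fps_coeff ?H (int a - int m) * ?Q $ m)"
    by (rule sum.mono_neutral_left) auto
  also have "\<dots> = (\<Sum>m<?n. fps_coeff ?H (int a - int m) * ?Q $ m)"
    by (rule sum.mono_neutral_right) (auto simp: Q0 simp del: fps_mult_nth)
  also have "\<dots> = (\<Sum>l = 1..?n. fps_coeff ?H (int a - int ?n + int l) * ?Q $ (?n - l))"
    by (rule sum.reindex_bij_witness[of _ "\<lambda>l. ?n - l" "\<lambda>m. ?n - m"])
      (auto simp: of_nat_diff algebra_simps)
  also have "\<dots> = (\<Sum>l = 1..?n. fps_coeff ?H (int a - int ?n + int l) *
      (\<Sum>j = 1..?n. fps_coeff ?E (int j - int l) * ?y ^ (?n - j)))"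
    by (rule sum.cong) (simp_all only: Ql)
  also have "\<dots> = (\<Sum>l = 1..?n. \<Sum>j = 1..?n. fps_coeff ?H (int a - int ?n + int l) *
      fps_coeff ?E (int j - int l) * ?y ^ (?n - j))"
    by (simp only: sum_distrib_left mult.assoc)
  also have "\<dots> = (\<Sum>j = 1..?n. \<Sum>l = 1..?n. fps_coeff ?H (int a - int ?n + int l) *
      fps_coeff ?E (int j - int l) * ?y ^ (?n - j))"
    by (rule sum.swap)
  finally show ?thesis
    by (simp only: sum_distrib_right)
qed

section \<open>Splitting off the determinant\<close>

definition complete_det :: "(nat \<Rightarrow> nat) \<Rightarrow> ('k::field, 'n::finite) ypoly"
  where "complete_det lam =
    det (mat CARD('n) CARD('n) (\<lambda>(i, j). fps_coeff complete_fps (int (lam (i + 1)) - int i + int j)))"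

lemma symmetric_mult: "symmetric f \<Longrightarrow> symmetric g \<Longrightarrow> symmetric (f * g)"
  unfolding symmetric_def using psi_invariant_mult by blast

lemma symmetric_sum: "(\<And>x. x \<in> A \<Longrightarrow> symmetric (f x)) \<Longrightarrow> symmetric (sum f A)"
  unfolding symmetric_def by (intro ballI psi_invariant_sum) blast

lemma symmetric_fps_coeff: "(\<And>k. symmetric (F $ k)) \<Longrightarrow> symmetric (fps_coeff F z)"
  by (simp add: fps_coeff_def) (simp add: symmetric_def)

lemma sandwich_complete_det:
  "sandwich (ymonom (\<lambda>i. lam i + (CARD('n) - i))) =
    ypoly_val (complete_det lam) * sandwich (ymonom (\<lambda>i. CARD('n) - i) :: ('k::field, 'n::finite) ypoly)"
proof -
  let ?n = "CARD('n)"
  let ?a = "\<lambda>i. lam i + (?n - i)"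
  let ?H = "complete_fps :: ('k, 'n) ypoly fps" and ?E = "elementary_fps :: ('k, 'n) ypoly fps"
  let ?C = "\<lambda>i j. \<Sum>l = 1..?n. fps_coeff ?H (int (?a i) - int ?n + int l) * fps_coeff ?E (int j - int l)"
  let ?h = "mat ?n ?n (\<lambda>(i, j). fps_coeff ?H (int (lam (i + 1)) - int i + int j))"
  let ?e = "mat ?n ?n (\<lambda>(i, j). fps_coeff ?E (int j - int i))"
  have "mat ?n ?n (\<lambda>(i, j). ?C (i + 1) (j + 1)) = ?h * ?e"
  proof (rule eq_matI)
    fix i j assume "i < dim_row (?h * ?e)" "j < dim_col (?h * ?e)"
    then have ij: "i < ?n" "j < ?n" by simp_all
    have "?C (i + 1) (j + 1) =
        (\<Sum>l = 0..<?n. fps_coeff ?H (int (lam (i + 1)) - int i + int l) * fps_coeff ?E (int j - int l))"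
      by (rule sum.reindex_bij_witness[of _ Suc "\<lambda>l. l - 1"])
        (use ij in \<open>auto simp: of_nat_diff algebra_simps\<close>)
    also have "\<dots> = (?h * ?e) $$ (i, j)"
      using ij by (simp add: scalar_prod_def)
    finally show "mat ?n ?n (\<lambda>(i, j). ?C (i + 1) (j + 1)) $$ (i, j) = (?h * ?e) $$ (i, j)"
      using ij by simp
  qed simp_all
  then have "leibniz_det ?n ?C = det (?h * ?e)"
    by (simp only: leibniz_det_eq_det)
  also have "\<dots> = det ?h * det ?e"
    by (rule det_mult[of _ ?n]) simp_all
  also have "det ?e = 1"
    by (rule det_fps_coeff_unitriangular[OF elementary_fps_0])
  finally have C: "leibniz_det ?n ?C = complete_det lam"
    by (simp add: complete_det_def)
  have "sandwich (ymonom ?a) = ypoly_val (leibniz_det ?n ?C) * sandwich (ymonom (\<lambda>i. ?n - i))"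
  proof (rule sandwich_determinant)
    show "symmetric (?C i j)" for i j
      by (intro symmetric_sum symmetric_mult symmetric_fps_coeff symmetric_complete_fps
          symmetric_elementary_fps)
    show "yvar i ^ ?a i = (\<Sum>j = 1..?n. ?C i j * yvar i ^ (?n - j))" if "i \<in> {1..?n}" for i
      by (rule yvar_power_expansion[OF that])
  qed
  then show ?thesis unfolding C .
qed

text \<open>
  The monomial is \<open>y\<^sub>r\<close> times one that commutes with \<open>\<psi>\<^sub>r\<close>, and \<open>\<psi>\<^sub>r y\<^sub>r = y\<^bsub>r+1\<^esub> \<psi>\<^sub>r - 1\<close>, where the first
  term annihilates \<open>psi_longest\<close>.
\<close>

lemma psi_lowers_exponent:
  assumes r: "r \<in> {1..<CARD('n)}" and a: "a r = Suc (a (r + 1))"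
  shows "nh_psi r * ypoly_val (ymonom a) * psi_longest =
    - (ypoly_val (ymonom (a(r := a (r + 1)))) * psi_longest :: ('k::field, 'n::finite) nilhecke)"
proof -
  let ?b = "a(r := a (r + 1))"
  let ?R = "\<lambda>a. \<Prod>i\<in>{1..CARD('n)} - {r, r + 1}. yvar i ^ a i :: ('k, 'n) ypoly"
  have R: "?R a = ?R ?b" by (rule prod.cong) auto
  have split: "(ymonom a :: ('k, 'n) ypoly) = ymonom ?b * yvar r"
    unfolding ymonom_split[OF r, of a] ymonom_split[OF r, of ?b] R by (simp add: a algebra_simps)
  have "psi_invariant r (ymonom ?b :: ('k, 'n) ypoly)"
  proof -
    have "(ymonom ?b :: ('k, 'n) ypoly) = ?R ?b * (yvar r * yvar (r + 1)) ^ a (r + 1)"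
      unfolding ymonom_split[OF r, of ?b] by (simp add: power_mult_distrib)
    then show ?thesis
      by (simp only: psi_invariant_mult[OF psi_invariant_rest[OF r]
            psi_invariant_power[OF psi_invariant_elementary(2)[OF r]]])
  qed
  then have comm: "nh_psi r * ypoly_val (ymonom ?b) = (ypoly_val (ymonom ?b) * nh_psi r :: ('k, 'n) nilhecke)"
    by (simp only: psi_invariant_def)
  have y: "ypoly_val (yvar r) = (nh_y r :: ('k, 'n) nilhecke)"
    by (rule ypoly_val_yvar) (use r in auto)
  have "nh_psi r * ypoly_val (ymonom a) * psi_longest =
      (ypoly_val (ymonom ?b) * (nh_psi r * nh_y r) * psi_longest :: ('k, 'n) nilhecke)"
    unfolding split ypoly_val_simps y mult.assoc[symmetric] comm ..
  also have "\<dots> = ypoly_val (ymonom ?b) * (nh_y (r + 1) * (nh_psi r * psi_longest) - psi_longest)"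
    by (simp only: nh_psi_y[OF r] mult.assoc left_diff_distrib mult_1_left)
  finally show ?thesis
    by (simp add: psi_mult_longest[OF r])
qed

text \<open>
  Read from the right, the run applies \<open>\<psi>\<^sub>1\<close>, then \<open>\<psi>\<^sub>2\<close>, and so on. After \<open>r\<close> steps the first \<open>r\<close> exponents
  of the staircase have dropped by one, so that the exponents at \<open>r + 1\<close> and \<open>r + 2\<close> differ by one again.
  Only the square of the sign matters for the idempotency, so it is left open.
\<close>

lemma psi_descending_run_lowers_staircase:
  assumes "r \<le> k" "k < CARD('n)"
  shows "prod_list (map nh_psi (rev [1..<r + 1])) * ypoly_val (ymonom (\<lambda>i. Suc k - i)) * psi_longest \<in>
    {ypoly_val (ymonom (\<lambda>i. if i \<le> r then k - i else Suc k - i)) * psi_longest,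
     - (ypoly_val (ymonom (\<lambda>i. if i \<le> r then k - i else Suc k - i)) * psi_longest
        :: ('k::field, 'n::finite) nilhecke)}"
  using assms(1)
proof (induction r)
  case 0
  have "(ymonom (\<lambda>i. if i \<le> 0 then k - i else Suc k - i) :: ('k, 'n) ypoly) = ymonom (\<lambda>i. Suc k - i)"
    unfolding ymonom_def by (rule prod.cong) auto
  then show ?case by simp
next
  case (Suc r)
  let ?e = "\<lambda>r i. if i \<le> r then k - i else Suc k - i"
  let ?Z = "\<lambda>r. ypoly_val (ymonom (?e r)) * psi_longest :: ('k, 'n) nilhecke"
  have r: "Suc r \<in> {1..<CARD('n)}" using Suc.prems assms(2) by auto
  have e: "(?e r)(Suc r := ?e r (Suc r + 1)) = ?e (Suc r)"
    using Suc.prems by (auto simp: fun_eq_iff)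
  \<comment> \<open>the exponents at \<open>r + 1\<close> and \<open>r + 2\<close> are \<open>k - r\<close> and \<open>k - r - 1\<close>\<close>
  have step: "nh_psi (Suc r) * ?Z r = - ?Z (Suc r)"
    using psi_lowers_exponent[OF r, of "?e r", where 'k = 'k] Suc.prems
    unfolding e by (simp add: mult.assoc)
  have "rev [1..<Suc r + 1] = Suc r # rev [1..<r + 1]" by simp
  then have "prod_list (map nh_psi (rev [1..<Suc r + 1])) * ypoly_val (ymonom (\<lambda>i. Suc k - i)) * psi_longest =
      nh_psi (Suc r) * (prod_list (map nh_psi (rev [1..<r + 1])) *
        ypoly_val (ymonom (\<lambda>i. Suc k - i)) * psi_longest :: ('k, 'n) nilhecke)"
    by (simp only: list.map prod_list.Cons mult.assoc)
  also have "\<dots> \<in> {nh_psi (Suc r) * ?Z r, - (nh_psi (Suc r) * ?Z r)}"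
    using Suc.IH Suc.prems by auto
  also have "{nh_psi (Suc r) * ?Z r, - (nh_psi (Suc r) * ?Z r)} = {?Z (Suc r), - ?Z (Suc r)}"
    unfolding step by auto
  finally show ?case .
qed

lemma psi_staircase_word_annihilates_staircase:
  assumes "k \<le> CARD('n)"
  shows "prod_list (map nh_psi (staircase_word k)) * ypoly_val (ymonom (\<lambda>i. k - i)) * psi_longest \<in>
    {psi_longest, - (psi_longest :: ('k::field, 'n::finite) nilhecke)}"
  using assms
proof (induction k)
  case 0
  show ?case by (simp add: ymonom_def)
next
  case (Suc k)
  let ?P = "prod_list (map nh_psi (staircase_word k)) :: ('k, 'n) nilhecke"
  let ?Z = "ypoly_val (ymonom (\<lambda>i. k - i)) * psi_longest :: ('k, 'n) nilhecke"
  have "(ymonom (\<lambda>i. if i \<le> k then k - i else Suc k - i) :: ('k, 'n) ypoly) = ymonom (\<lambda>i. k - i)"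
    unfolding ymonom_def by (rule prod.cong) auto
  then have run: "prod_list (map nh_psi (rev [1..<k + 1])) * ypoly_val (ymonom (\<lambda>i. Suc k - i)) * psi_longest
      \<in> {?Z, - ?Z}"
    using psi_descending_run_lowers_staircase[of k k, where 'k = 'k and 'n = 'n] Suc.prems by simp
  have "prod_list (map nh_psi (staircase_word (Suc k))) * ypoly_val (ymonom (\<lambda>i. Suc k - i)) * psi_longest =
      ?P * (prod_list (map nh_psi (rev [1..<k + 1])) * ypoly_val (ymonom (\<lambda>i. Suc k - i)) * psi_longest)"
    by (simp only: staircase_word.simps map_append prod_list.append mult.assoc)
  also have "\<dots> \<in> {?P * ?Z, - (?P * ?Z)}"
    using run by auto
  also have "{?P * ?Z, - (?P * ?Z)} \<subseteq> {psi_longest, - psi_longest}"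
    using Suc by (auto simp: mult.assoc)
  finally show ?case .
qed

lemma sandwich_staircase:
  "sandwich (ymonom (\<lambda>i. CARD('n) - i) :: ('k::field, 'n::finite) ypoly) \<in> {psi_longest, - psi_longest}"
  using psi_staircase_word_annihilates_staircase[of "CARD('n)", where 'k = 'k and 'n = 'n]
  unfolding sandwich_def psi_longest_staircase by simp

abbreviation b_empty :: "('k::field, 'n::finite) nilhecke"
  where "b_empty \<equiv> nh_b (\<lambda>_. 0)"

lemma nh_b_eq_sandwich:
  "nh_b lam = sandwich (ymonom (\<lambda>i. lam i + (CARD('n) - i))) *
    ypoly_val (ymonom (\<lambda>i. CARD('n) - i) :: ('k::field, 'n::finite) ypoly)"
proof -
  have val: "prod_list (map (\<lambda>i. nh_y i ^ a i) [1..<CARD('n) + 1]) =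
      ypoly_val (ymonom a :: ('k, 'n) ypoly)" for a
  proof -
    have "(ymonom a :: ('k, 'n) ypoly) = prod_list (map (\<lambda>i. yvar i ^ a i) [1..<CARD('n) + 1])"
      unfolding ymonom_def by (rule prod_list_map_upt[symmetric])
    then have "ypoly_val (ymonom a :: ('k, 'n) ypoly) =
        prod_list (map (ypoly_val \<circ> (\<lambda>i. yvar i ^ a i)) [1..<CARD('n) + 1])"
      by (simp only: ypoly_val_prod_list map_map)
    also have "map (ypoly_val \<circ> (\<lambda>i. yvar i ^ a i :: ('k, 'n) ypoly)) [1..<CARD('n) + 1] =
        map (\<lambda>i. nh_y i ^ a i) [1..<CARD('n) + 1]"
      by (rule map_cong) (auto simp: ypoly_val_power)
    finally show ?thesis ..
  qed
  show ?thesis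
    unfolding nh_b_def sandwich_def val ..
qed

lemma nh_b_eq_complete_det:
  "nh_b lam = ypoly_val (complete_det lam) * (b_empty :: ('k::field, 'n::finite) nilhecke)"
  unfolding nh_b_eq_sandwich sandwich_complete_det[of lam] by (simp add: mult.assoc)

text \<open>
  If \<open>\<psi> y\<^sup>\<delta> \<psi> = \<epsilon> \<psi>\<close> with \<open>\<epsilon> = \<plusminus>1\<close>, then \<open>\<psi> y\<^sup>\<delta> \<psi> y\<^sup>\<delta> \<psi> = \<epsilon>\<^sup>2 \<psi> = \<psi>\<close>.
\<close>

lemma b_empty_idempotent: "b_empty * b_empty = (b_empty :: ('k::field, 'n::finite) nilhecke)"
proof -
  let ?d = "ypoly_val (ymonom (\<lambda>i. CARD('n) - i)) :: ('k, 'n) nilhecke"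
  let ?p = "psi_longest :: ('k, 'n) nilhecke"
  have b: "b_empty = ?p * ?d * ?p * ?d"
    by (simp add: nh_b_eq_sandwich sandwich_def)
  have "?p * ?d * ?p = ?p \<or> ?p * ?d * ?p = - ?p"
    using sandwich_staircase[where 'k = 'k and 'n = 'n] by (simp add: sandwich_def)
  then have "?p * ?d * (?p * ?d * ?p) = ?p"
    by (elim disjE) simp_all
  then have "?p * ?d * ?p * ?d * ?p = ?p"
    by (simp only: mult.assoc)
  then show ?thesis
    unfolding b by (simp only: mult.assoc[symmetric])
qed

lemma symmetric_commute_b_empty:
  assumes "symmetric (f :: ('k::field, 'n::finite) ypoly)"
  shows "b_empty * ypoly_val f = ypoly_val f * b_empty"
proof -
  let ?d = "ypoly_val (ymonom (\<lambda>i. CARD('n) - i)) :: ('k, 'n) nilhecke"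
  let ?p = "psi_longest :: ('k, 'n) nilhecke" and ?f = "ypoly_val f"
  have b: "b_empty = ?p * ?d * ?p * ?d"
    by (simp add: nh_b_eq_sandwich sandwich_def)
  have p: "?f * ?p = ?p * ?f" by (rule symmetric_commute_psi_longest[OF assms])
  have d: "?f * ?d = ?d * ?f" by (rule ypoly_val_commute)
  have "?f * b_empty = (?f * ?p) * ?d * ?p * ?d" unfolding b by (simp only: mult.assoc)
  also have "\<dots> = ?p * (?f * ?d) * ?p * ?d" unfolding p by (simp only: mult.assoc)
  also have "\<dots> = ?p * ?d * (?f * ?p) * ?d" unfolding d by (simp only: mult.assoc)
  also have "\<dots> = ?p * ?d * ?p * (?f * ?d)" unfolding p by (simp only: mult.assoc)
  also have "\<dots> = b_empty * ?f" unfolding d b by (simp only: mult.assoc)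
  finally show ?thesis ..
qed

text \<open>
  Symmetric factors move to the left past the copies of \<open>b_empty\<close>, which then merge into one. An empty
  product would be \<open>1\<close> and not \<open>b_empty\<close>; this is why \<open>m \<ge> 1\<close> is assumed for the determinants.
\<close>

lemma prod_list_mult_b_empty:
  fixes c :: "nat \<Rightarrow> ('k::field, 'n::finite) ypoly"
  assumes "\<And>i. symmetric (c i)" "is \<noteq> []"
  shows "prod_list (map (\<lambda>i. ypoly_val (c i) * b_empty) is) = ypoly_val (prod_list (map c is)) * b_empty"
  using assms(2)
proof (induction "is" rule: list_nonempty_induct)
  case (single i)
  then show ?case by simp
next
  case (cons i "is")
  have "prod_list (map (\<lambda>i. ypoly_val (c i) * b_empty) (i # is)) =
      ypoly_val (c i) * (b_empty * ypoly_val (prod_list (map c is))) * b_empty"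
    using cons by (simp add: mult.assoc)
  also have "b_empty * ypoly_val (prod_list (map c is)) = ypoly_val (prod_list (map c is)) * b_empty"
  proof (rule symmetric_commute_b_empty)
    show "symmetric (prod_list (map c is))"
      by (induction "is") (auto intro: symmetric_mult assms(1) simp: symmetric_def[of 1])
  qed
  also have "ypoly_val (c i) * (ypoly_val (prod_list (map c is)) * b_empty) * b_empty =
      ypoly_val (c i) * ypoly_val (prod_list (map c is)) * (b_empty * b_empty)"
    by (simp only: mult.assoc)
  finally show ?case
    by (simp add: b_empty_idempotent)
qed

lemma leibniz_det_mult_b_empty:
  fixes C :: "nat \<Rightarrow> nat \<Rightarrow> ('k::field, 'n::finite) ypoly"
  assumes "\<And>i j. symmetric (C i j)" "m \<ge> 1"
  shows "leibniz_det m (\<lambda>i j. ypoly_val (C i j) * b_empty) = ypoly_val (leibniz_det m C) * b_empty"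
proof -
  have "prod_list (map (\<lambda>i. ypoly_val (C i (\<sigma> i)) * b_empty) [1..<m + 1]) =
      ypoly_val (prod_list (map (\<lambda>i. C i (\<sigma> i)) [1..<m + 1])) * b_empty" for \<sigma>
    by (rule prod_list_mult_b_empty) (use assms in auto)
  then show ?thesis
    unfolding leibniz_det_def ypoly_val_sum sum_distrib_right
    by (intro sum.cong) (auto simp: mult.assoc)
qed

section \<open>Rows and columns\<close>

definition elementary_signless_fps :: "('k::field, 'n::finite) ypoly fps"
  where "elementary_signless_fps = Abs_fps (\<lambda>k. (- 1) ^ k * elementary_fps $ k)"

lemma complete_det_row:
  "(complete_det (row_partition s) :: ('k::field, 'n::finite) ypoly) = complete_fps $ s"
proof -
  let ?n = "CARD('n)"
  let ?A = "mat ?n ?n (\<lambda>(i, j). fps_coeff complete_fps (int (row_partition s (i + 1)) - int i + int j))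
    :: ('k, 'n) ypoly mat"
  have "det ?A = prod_list (diag_mat ?A)"
    by (rule det_upper_triangular[of _ ?n]) (auto intro!: upper_triangularI simp: row_partition_def)
  also have "diag_mat ?A = map (\<lambda>i. if i = 0 then complete_fps $ s else 1) [0..<?n]"
    by (auto simp: diag_mat_def row_partition_def complete_fps_0)
  also have "[0..<?n] = 0 # [1..<?n]"
    by (simp add: upt_conv_Cons)
  also have "map (\<lambda>i. if i = 0 then complete_fps $ s else 1) (0 # [1..<?n]) =
      (complete_fps $ s :: ('k, 'n) ypoly) # map (\<lambda>_. 1) [1..<?n]"
    by simp
  finally show ?thesis
    by (simp add: complete_det_def map_replicate_const)
qed

lemma complete_det_eq_elementary_det:
  assumes "lam \<in> partitions CARD('n)" "lam 1 \<le> m"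
  shows "(complete_det lam :: ('k::field, 'n::finite) ypoly) =
    leibniz_det m (\<lambda>i j. fps_coeff elementary_signless_fps (int (conjugate lam i) - int i + int j))"
  unfolding complete_det_def leibniz_det_eq_det elementary_signless_fps_def
    jacobi_trudi_dual[OF complete_mult_elementary complete_fps_0 assms]
  by (simp add: algebra_simps)

text \<open>
  The dual determinant of a single column is the \<open>1 \<times> 1\<close> determinant \<open>e\<^sub>k\<close>.
\<close>

lemma complete_det_column:
  assumes "k \<le> CARD('n)"
  shows "(complete_det (column_partition k) :: ('k::field, 'n::finite) ypoly) = elementary_signless_fps $ k"
proof -
  have part: "column_partition k \<in> partitions CARD('n)"
    using assms by (auto simp: partitions_def column_partition_def)
  have "{j. 1 \<le> column_partition k j} = {1..k}"
    by (auto simp: column_partition_def)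
  then have "conjugate (column_partition k) 1 = k"
    by (simp add: conjugate_def)
  moreover have "column_partition k 1 \<le> 1"
    by (simp add: column_partition_def)
  ultimately show ?thesis
    using complete_det_eq_elementary_det[OF part, of 1]
    unfolding leibniz_det_eq_det by (simp add: det_single)
qed

lemma b_row_eq: "b_row s = ypoly_val (fps_coeff complete_fps s) * (b_empty :: ('k::field, 'n::finite) nilhecke)"
proof (cases "s < 0")
  case False
  then show ?thesis
    using nh_b_eq_complete_det[of "row_partition (nat s)", where 'k = 'k and 'n = 'n]
    by (simp add: b_row_def fps_coeff_def complete_det_row)
qed (simp add: b_row_def)

lemma b_column_eq:
  "b_column s = ypoly_val (fps_coeff elementary_signless_fps s) * (b_empty :: ('k::field, 'n::finite) nilhecke)"
proof (cases "s < 0 \<or> int CARD('n) < s")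
  case True
  have "(elementary_fps :: ('k, 'n) ypoly fps) $ nat s = 0" if "int CARD('n) < s"
    by (rule elementary_fps_nth_eq_0) (use that in linarith)
  then show ?thesis
    using True by (auto simp: b_column_def fps_coeff_def elementary_signless_fps_def)
next
  case False
  then have "nat s \<le> CARD('n)" by linarith
  then show ?thesis
    using False nh_b_eq_complete_det[of "column_partition (nat s)", where 'k = 'k and 'n = 'n]
    by (simp add: b_column_def fps_coeff_def complete_det_column)
qed

lemma symmetric_elementary_signless_fps:
  "symmetric ((elementary_signless_fps :: ('k::field, 'n::finite) ypoly fps) $ k)"
proof -
  have "psi_invariant r ((- 1) ^ k :: ('k, 'n) ypoly)" for r
    by (intro psi_invariant_power psi_invariant_minus psi_invariant_basic)
  then have "symmetric ((- 1) ^ k :: ('k, 'n) ypoly)"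
    by (simp add: symmetric_def)
  then show ?thesis
    by (simp add: elementary_signless_fps_def symmetric_mult symmetric_elementary_fps)
qed

theorem lemma3p25:
  fixes lam :: "nat \<Rightarrow> nat" and m :: nat
  assumes "lam \<in> partitions CARD('n)"
    and "m \<ge> 1" and "m \<ge> part_length (conjugate lam)"
  shows "(nh_b lam :: ('k::field, 'n::finite) nilhecke) =
      leibniz_det CARD('n) (\<lambda>i j. b_row (int (lam i) - int i + int j))
    \<and> (nh_b lam :: ('k, 'n) nilhecke) =
      leibniz_det m (\<lambda>i j. b_column (int (conjugate lam i) - int i + int j))"
proof
  have m: "lam 1 \<le> m"
    using assms(3) part_length_conjugate[OF assms(1)] by simp
  have n: "CARD('n) \<ge> 1"
    by (simp add: Suc_le_eq)
  have "complete_det lam =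
      leibniz_det CARD('n) (\<lambda>i j. fps_coeff complete_fps (int (lam i) - int i + int j) :: ('k, 'n) ypoly)"
    unfolding complete_det_def leibniz_det_eq_det by (simp add: algebra_simps)
  then show "(nh_b lam :: ('k, 'n) nilhecke) =
      leibniz_det CARD('n) (\<lambda>i j. b_row (int (lam i) - int i + int j))"
    unfolding b_row_eq nh_b_eq_complete_det[of lam]
    by (simp only: leibniz_det_mult_b_empty[OF symmetric_fps_coeff[OF symmetric_complete_fps] n])
  show "(nh_b lam :: ('k, 'n) nilhecke) =
      leibniz_det m (\<lambda>i j. b_column (int (conjugate lam i) - int i + int j))"
    unfolding b_column_eq nh_b_eq_complete_det[of lam] complete_det_eq_elementary_det[OF assms(1) m]
    by (simp only: leibniz_det_mult_b_empty[OF symmetric_fps_coeff[OF symmetric_elementary_signless_fps] assms(2)])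
qed

end
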